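(* For every welded knot $K$, the welded unknotting number does not exceed twice the unknotting number: $u_w(K)\le 2\,u(K)$.
   Context: A virtual knot diagram is the image of a generic immersion $S^1\to\mathbb{R}^2$ with finitely many transverse double points, each marked either as a classical crossing (with over/under information) or as a virtual crossing (also called a welded crossing). A welded knot is an equivalence class of virtual knot diagrams under planar isotopy and finite sequences of: the classical Reidemeister moves $R_1,R_2,R_3$; the virtual Reidemeister moves $vR_1,vR_2,vR_3$ (the analogues of $R_1,R_2,R_3$ with all crossings virtual); $vR_4$ (a strand having two consecutive virtual crossings is slid across a classical crossing); and the over-forbidden move $F_o$ (a strand that is the over-strand at two consecutive classical crossings is slid across a virtual crossing of the two other strands). The unknot (trivial welded knot) is the class of an embedded circle in the plane. Welding a classical crossing means replacing it by a welded (virtual) crossing. For a welded knot diagram $D$, $u_w(D)$ is the minimum number of classical crossings of $D$ that need to be welded so that the resulting diagram is a diagram of the unknot. For a welded knot $K$, $u_w(K)=\min\{u_w(D): D\text{ is a diagram of }K\}$. The unknotting number $u(K)$ of a welded knot $K$ is the minimum, over all diagrams $D$ of $K$, of the number of classical crossings of $D$ at which the over/under information must be switched (crossing changes) to obtain a diagram of the unknot. *)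

theory Defs
  imports "HOL-Analysis.Analysis" "HOL-Library.Extended_Nat"
begin

section \<open>Virtual knot diagrams\<close>

text \<open>The circle is \<open>\<real>/\<int>\<close>: a closed curve is a 1-periodic map on \<open>\<real>\<close>, and a set of points of the
  circle is a set of reals that is invariant under translation by 1.\<close>

type_synonym plane = "real \<times> real"

definition same_image :: "(real \<Rightarrow> plane) \<Rightarrow> real \<Rightarrow> real \<Rightarrow> bool" where
  "same_image \<gamma> s t \<longleftrightarrow> s - t \<notin> \<int> \<and> \<gamma> s = \<gamma> t"

definition double_points :: "(real \<Rightarrow> plane) \<Rightarrow> plane set" where
  "double_points \<gamma> = {p. \<exists>s t. same_image \<gamma> s t \<and> \<gamma> s = p}"

definition linearly_independent2 :: "plane \<Rightarrow> plane \<Rightarrow> bool" where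
  "linearly_independent2 v w \<longleftrightarrow> fst v * snd w - snd v * fst w \<noteq> 0"

definition generic_immersion :: "(real \<Rightarrow> plane) \<Rightarrow> bool" where
  "generic_immersion \<gamma> \<longleftrightarrow>
     (\<forall>t. \<gamma> (t + 1) = \<gamma> t) \<and>
     \<gamma> C1_differentiable_on UNIV \<and>
     (\<forall>t. vector_derivative \<gamma> (at t) \<noteq> 0) \<and>
     finite (double_points \<gamma>) \<and>
     (\<forall>r s t. \<gamma> r = \<gamma> s \<and> \<gamma> s = \<gamma> t \<longrightarrow> r - s \<in> \<int> \<or> s - t \<in> \<int> \<or> r - t \<in> \<int>) \<and>
     (\<forall>s t. same_image \<gamma> s t \<longrightarrow>
        linearly_independent2 (vector_derivative \<gamma> (at s)) (vector_derivative \<gamma> (at t)))"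

text \<open>The marking of the double points is recorded by the set of parameters at which the curve
  passes over: a double point is a classical crossing if one of its two parameters is in this set
  (that branch is then the over-strand) and a virtual crossing if neither is.\<close>

record vdiagram =
  curve :: "real \<Rightarrow> plane"
  over :: "real set"

definition virtual_diagram :: "vdiagram \<Rightarrow> bool" where
  "virtual_diagram D \<longleftrightarrow>
     generic_immersion (curve D) \<and>
     (\<forall>t. t + 1 \<in> over D \<longleftrightarrow> t \<in> over D) \<and>
     (\<forall>t\<in>over D. \<exists>s. same_image (curve D) s t) \<and>
     (\<forall>s t. same_image (curve D) s t \<and> s \<in> over D \<longrightarrow> t \<notin> over D)"

definition classical_crossings :: "vdiagram \<Rightarrow> plane set" where
  "classical_crossings D = curve D ` over D"


section \<open>Planar isotopy\<close>

text \<open>A diagram is the marked \<^emph>\<open>image\<close> of an immersion, so an isotopy need only match the curves up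
  to a reparametrisation of the circle, which may reverse the direction.\<close>

definition circle_reparam :: "(real \<Rightarrow> real) \<Rightarrow> bool" where
  "circle_reparam f \<longleftrightarrow>
     (\<exists>g. homeomorphism UNIV UNIV f g) \<and>
     ((\<forall>t. f (t + 1) = f t + 1) \<or> (\<forall>t. f (t + 1) = f t - 1))"

definition planar_isotopic :: "vdiagram \<Rightarrow> vdiagram \<Rightarrow> bool" where
  "planar_isotopic D E \<longleftrightarrow>
     (\<exists>(h :: plane \<Rightarrow> plane) f.
        homotopic_with (\<lambda>k. \<exists>g. homeomorphism UNIV UNIV k g) euclidean euclidean id h \<and>
        circle_reparam f \<and>
        curve E = h \<circ> curve D \<circ> f \<and> over E = f -` over D)"


section \<open>Local moves\<close>

text \<open>A local move replaces the part of a diagram inside a closed disc \<open>B\<close> of the plane. The diagram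
  meets \<open>B\<close> in finitely many strands, given by parameter intervals \<open>(a, b)\<close> of length less than 1;
  the end points of the strands, and no others of their points, lie on the boundary of \<open>B\<close>.\<close>

type_synonym strand = "real \<times> real"

definition open_strand :: "strand \<Rightarrow> real set" where
  "open_strand I = (\<Union>n::int. {fst I + of_int n <..< snd I + of_int n})"

definition closed_strand :: "strand \<Rightarrow> real set" where
  "closed_strand I = (\<Union>n::int. {fst I + of_int n .. snd I + of_int n})"

definition meets_in_strands :: "vdiagram \<Rightarrow> plane set \<Rightarrow> strand list \<Rightarrow> bool" where
  "meets_in_strands D B L \<longleftrightarrow>
     curve D -` B = (\<Union>I\<in>set L. closed_strand I) \<and>
     curve D -` interior B = (\<Union>I\<in>set L. open_strand I)"

definition local_change :: "plane set \<Rightarrow> strand list \<Rightarrow> vdiagram \<Rightarrow> vdiagram \<Rightarrow> bool" where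
  "local_change B L D E \<longleftrightarrow>
     B homeomorphic cball (0::plane) 1 \<and>
     distinct L \<and> (\<forall>I\<in>set L. fst I < snd I \<and> snd I < fst I + 1) \<and>
     pairwise (\<lambda>I J. disjnt (closed_strand I) (closed_strand J)) (set L) \<and>
     meets_in_strands D B L \<and> meets_in_strands E B L \<and>
     (\<forall>t. t \<notin> (\<Union>I\<in>set L. open_strand I) \<longrightarrow>
        curve D t = curve E t \<and> (t \<in> over D \<longleftrightarrow> t \<in> over E))"

definition over_crossing :: "vdiagram \<Rightarrow> strand \<Rightarrow> strand \<Rightarrow> plane \<Rightarrow> bool" where
  "over_crossing D I J p \<longleftrightarrow>
     (\<exists>s\<in>open_strand I. \<exists>t\<in>open_strand J.
        same_image (curve D) s t \<and> curve D s = p \<and> s \<in> over D)"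

definition virtual_crossing :: "vdiagram \<Rightarrow> strand \<Rightarrow> strand \<Rightarrow> plane \<Rightarrow> bool" where
  "virtual_crossing D I J p \<longleftrightarrow>
     (\<exists>s\<in>open_strand I. \<exists>t\<in>open_strand J.
        same_image (curve D) s t \<and> curve D s = p \<and> s \<notin> over D \<and> t \<notin> over D)"

text \<open>The pictures of the Reidemeister moves. Inside a disc, each picture is determined, up to
  isotopy fixing the boundary and up to the mirror images and strand directions that the moves allow,
  by which strands cross, how often and how:
  \<^item> one strand with exactly one crossing is a curl;
  \<^item> two strands with exactly two crossings, both between the two strands, bound a bigon;
  \<^item> three strands of which every two cross exactly once, and which have no further crossing, bound a
    triangle; for given end points there are two such pictures, and the move that slides a strand
    across the crossing of the two others passes from one to the other.

  The parameters \<open>\<kappa>\<close> give the kind of each crossing.\<close>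

type_synonym crossing_kind = "vdiagram \<Rightarrow> strand \<Rightarrow> strand \<Rightarrow> plane \<Rightarrow> bool"

definition crossingless :: "vdiagram \<Rightarrow> plane set \<Rightarrow> bool" where
  "crossingless D B \<longleftrightarrow> double_points (curve D) \<inter> B = {}"

definition curl :: "crossing_kind \<Rightarrow> vdiagram \<Rightarrow> plane set \<Rightarrow> strand \<Rightarrow> bool" where
  "curl \<kappa> D B I \<longleftrightarrow> (\<exists>p. double_points (curve D) \<inter> B = {p} \<and> \<kappa> D I I p)"

definition bigon :: "crossing_kind \<Rightarrow> vdiagram \<Rightarrow> plane set \<Rightarrow> strand \<Rightarrow> strand \<Rightarrow> bool" where
  "bigon \<kappa> D B I J \<longleftrightarrow>
     (\<exists>p q. p \<noteq> q \<and> double_points (curve D) \<inter> B = {p, q} \<and> \<kappa> D I J p \<and> \<kappa> D I J q)"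

definition triangle ::
  "crossing_kind \<Rightarrow> crossing_kind \<Rightarrow> crossing_kind \<Rightarrow>
   vdiagram \<Rightarrow> plane set \<Rightarrow> strand \<Rightarrow> strand \<Rightarrow> strand \<Rightarrow> bool" where
  "triangle \<kappa>\<^sub>1 \<kappa>\<^sub>2 \<kappa>\<^sub>3 D B I J K \<longleftrightarrow>
     (\<exists>p q r. distinct [p, q, r] \<and> double_points (curve D) \<inter> B = {p, q, r} \<and>
        \<kappa>\<^sub>1 D I J p \<and> \<kappa>\<^sub>2 D I K q \<and> \<kappa>\<^sub>3 D J K r)"

definition curl_move :: "crossing_kind \<Rightarrow> vdiagram \<Rightarrow> vdiagram \<Rightarrow> bool" where
  "curl_move \<kappa> D E \<longleftrightarrow>
     (\<exists>B I. local_change B [I] D E \<and> crossingless D B \<and> curl \<kappa> E B I)"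

definition bigon_move :: "crossing_kind \<Rightarrow> vdiagram \<Rightarrow> vdiagram \<Rightarrow> bool" where
  "bigon_move \<kappa> D E \<longleftrightarrow>
     (\<exists>B I J. local_change B [I, J] D E \<and> crossingless D B \<and> bigon \<kappa> E B I J)"

text \<open>The strand \<open>I\<close> is slid across the crossing of \<open>J\<close> and \<open>K\<close>. If both triangles are the same
  picture, the move is a planar isotopy.\<close>

definition triangle_move ::
  "crossing_kind \<Rightarrow> crossing_kind \<Rightarrow> crossing_kind \<Rightarrow> vdiagram \<Rightarrow> vdiagram \<Rightarrow> bool" where
  "triangle_move \<kappa>\<^sub>1 \<kappa>\<^sub>2 \<kappa>\<^sub>3 D E \<longleftrightarrow>
     (\<exists>B I J K. local_change B [I, J, K] D E \<and>
        triangle \<kappa>\<^sub>1 \<kappa>\<^sub>2 \<kappa>\<^sub>3 D B I J K \<and> triangle \<kappa>\<^sub>1 \<kappa>\<^sub>2 \<kappa>\<^sub>3 E B I J K)"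

abbreviation "R1 \<equiv> curl_move over_crossing"
abbreviation "R2 \<equiv> bigon_move over_crossing"
abbreviation "R3 \<equiv> triangle_move over_crossing over_crossing over_crossing"
abbreviation "vR1 \<equiv> curl_move virtual_crossing"
abbreviation "vR2 \<equiv> bigon_move virtual_crossing"
abbreviation "vR3 \<equiv> triangle_move virtual_crossing virtual_crossing virtual_crossing"
abbreviation "vR4 \<equiv> triangle_move virtual_crossing virtual_crossing over_crossing"
abbreviation "Fo \<equiv> triangle_move over_crossing over_crossing virtual_crossing"


section \<open>Welded knots\<close>

definition welded_step :: "vdiagram \<Rightarrow> vdiagram \<Rightarrow> bool" where
  "welded_step D E \<longleftrightarrow> virtual_diagram D \<and> virtual_diagram E \<and>
     (planar_isotopic D E \<or> R1 D E \<or> R2 D E \<or> R3 D E \<or>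
      vR1 D E \<or> vR2 D E \<or> vR3 D E \<or> vR4 D E \<or> Fo D E)"

definition welded_equivalence :: "(vdiagram \<times> vdiagram) set" where
  "welded_equivalence =
     {(D, E). virtual_diagram D \<and> virtual_diagram E \<and> equivclp welded_step D E}"

definition welded_knots :: "vdiagram set set" where
  "welded_knots = Collect virtual_diagram // welded_equivalence"

definition round_circle :: vdiagram where
  "round_circle = \<lparr>curve = (\<lambda>t. (cos (2 * pi * t), sin (2 * pi * t))), over = {}\<rparr>"

definition unknot :: "vdiagram set" where
  "unknot = welded_equivalence `` {round_circle}"


section \<open>Welding, crossing changes and unknotting numbers\<close>

definition weld :: "plane set \<Rightarrow> vdiagram \<Rightarrow> vdiagram" where
  "weld X D = D\<lparr>over := {t \<in> over D. curve D t \<notin> X}\<rparr>"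

definition switch :: "plane set \<Rightarrow> vdiagram \<Rightarrow> vdiagram" where
  "switch X D = D\<lparr>over := {t. (t \<in> over D) \<noteq> (curve D t \<in> X)}\<rparr>"

text \<open>The minima are taken in \<^typ>\<open>enat\<close>; the minimum of the empty set would be \<open>\<infinity>\<close>.\<close>

definition diagram_welded_unknotting_number :: "vdiagram \<Rightarrow> enat" where
  "diagram_welded_unknotting_number D =
     (INF X\<in>{X. X \<subseteq> classical_crossings D \<and> weld X D \<in> unknot}. enat (card X))"

definition welded_unknotting_number :: "vdiagram set \<Rightarrow> enat" where
  "welded_unknotting_number K = (INF D\<in>K. diagram_welded_unknotting_number D)"

definition diagram_unknotting_number :: "vdiagram \<Rightarrow> enat" where
  "diagram_unknotting_number D =
     (INF X\<in>{X. X \<subseteq> classical_crossings D \<and> switch X D \<in> unknot}. enat (card X))"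

definition unknotting_number :: "vdiagram set \<Rightarrow> enat" where
  "unknotting_number K = (INF D\<in>K. diagram_unknotting_number D)"


section \<open>Well-definedness of the notions\<close>

lemma equiv_welded_equivalence: "equiv (Collect virtual_diagram) welded_equivalence"
proof (rule equivI)
  show "refl_on (Collect virtual_diagram) welded_equivalence"
    by (auto simp: refl_on_def welded_equivalence_def)
  show "sym welded_equivalence"
    by (auto simp: sym_def welded_equivalence_def intro: equivclp_sym)
  show "trans welded_equivalence"
    by (auto simp: trans_def welded_equivalence_def intro: equivclp_trans)
qed (auto simp: welded_equivalence_def)

lemma finite_classical_crossings:
  assumes "virtual_diagram D"
  shows "finite (classical_crossings D)"
proof (rule finite_subset)
  show "classical_crossings D \<subseteq> double_points (curve D)"
    using assms unfolding virtual_diagram_def classical_crossings_def double_points_def same_image_def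
    by fastforce
  show "finite (double_points (curve D))"
    using assms by (auto simp: virtual_diagram_def generic_immersion_def)
qed

lemma virtual_diagram_weld:
  assumes "virtual_diagram D"
  shows "virtual_diagram (weld X D)"
  using assms by (auto simp: virtual_diagram_def weld_def generic_immersion_def)

lemma classical_crossings_weld: "classical_crossings (weld X D) = classical_crossings D - X"
  by (auto simp: classical_crossings_def weld_def)

lemma virtual_diagram_switch:
  assumes D: "virtual_diagram D" and X: "X \<subseteq> classical_crossings D"
  shows "virtual_diagram (switch X D)"
proof -
  let ?g = "curve D"
  have gen: "generic_immersion ?g" and per: "\<And>t. t + 1 \<in> over D \<longleftrightarrow> t \<in> over D"
    and ex: "\<And>t. t \<in> over D \<Longrightarrow> \<exists>s. same_image ?g s t"
    and un: "\<And>s t. same_image ?g s t \<Longrightarrow> s \<in> over D \<Longrightarrow> t \<notin> over D"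
    using D by (auto simp: virtual_diagram_def)
  have gper: "?g (t + 1) = ?g t" for t using gen by (auto simp: generic_immersion_def)
  have over_int: "t \<in> over D" if s: "s \<in> over D" and st: "s - t \<in> \<int>" for s t
  proof -
    have nat: "x + real n \<in> over D \<longleftrightarrow> x \<in> over D" for x n
    proof (induction n)
      case (Suc n)
      then show ?case using per[of "x + real n"] by (simp add: algebra_simps)
    qed simp
    obtain k :: int where k: "s - t = of_int k" using st by (auto elim: Ints_cases)
    show ?thesis
    proof (cases "k \<ge> 0")
      case True
      then have "s = t + real (nat k)" using k by simp
      then show ?thesis using s nat by simp
    next
      case False
      then have "t = s + real (nat (- k))" using k by simp
      then show ?thesis using s nat[of s "nat (- k)"] by simp
    qed
  qed
  have under: "\<exists>s\<in>over D. same_image ?g s t" if "?g t \<in> X" and t: "t \<notin> over D" for t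
  proof -
    obtain s where s: "s \<in> over D" "?g s = ?g t"
      using X \<open>?g t \<in> X\<close> by (auto simp: classical_crossings_def)
    then have "s - t \<notin> \<int>" using over_int t by blast
    with s show ?thesis by (auto simp: same_image_def)
  qed
  have A: "\<exists>s. same_image ?g s t" if "(t \<in> over D) \<noteq> (?g t \<in> X)" for t
    using that ex under by blast
  have B: "(t \<in> over D) = (?g t \<in> X)"
    if st: "same_image ?g s t" and s: "(s \<in> over D) \<noteq> (?g s \<in> X)" for s t
  proof (cases "s \<in> over D")
    case True
    then show ?thesis using st s un by (auto simp: same_image_def)
  next
    case False
    then have "?g s \<in> X" using s by simp
    then obtain r where r: "r \<in> over D" "same_image ?g r s" using under False by blast
    have "r - t \<in> \<int>"
      using gen r(2) st unfolding generic_immersion_def same_image_def by metis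
    then have "t \<in> over D" using r(1) over_int by blast
    then show ?thesis using \<open>?g s \<in> X\<close> st by (simp add: same_image_def)
  qed
  show ?thesis
    unfolding virtual_diagram_def switch_def
    using gen A B by (auto simp: per gper)
qed

lemma virtual_diagram_round_circle: "virtual_diagram round_circle"
proof -
  let ?g = "\<lambda>t::real. (cos (2 * pi * t), sin (2 * pi * t))"
  let ?d = "\<lambda>t::real. (- (2 * pi) * sin (2 * pi * t), 2 * pi * cos (2 * pi * t))"
  have der: "(?g has_vector_derivative ?d t) (at t)" for t
    by (rule has_vector_derivative_Pair)
       (auto intro!: derivative_eq_intros simp: has_real_derivative_iff_has_vector_derivative[symmetric])
  have inj: "s - t \<in> \<int>" if "?g s = ?g t" for s t
  proof -
    have "cos (2 * pi * s) = cos (2 * pi * t)" "sin (2 * pi * s) = sin (2 * pi * t)"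
      using that by auto
    then obtain n :: int where "2 * pi * s = 2 * pi * t + 2 * pi * n"
      by (metis sin_cos_eq_iff)
    then have "2 * pi * (s - t) = 2 * pi * of_int n" by (simp add: algebra_simps)
    then have "s - t = of_int n" by simp
    then show ?thesis by simp
  qed
  have C1: "?g C1_differentiable_on UNIV"
    unfolding C1_differentiable_on_def
    by (intro exI[of _ ?d] conjI ballI der continuous_intros)
  have nz: "vector_derivative ?g (at t) \<noteq> 0" for t
  proof -
    have "?d t \<noteq> 0"
      using sin_cos_squared_add[of "2 * pi * t"] by (auto simp: zero_prod_def simp del: sin_cos_squared_add)
    then show ?thesis using vector_derivative_at[OF der[of t]] by simp
  qed
  have ns: "\<not> same_image ?g s t" for s t using inj by (auto simp: same_image_def)
  have per: "?g (t + 1) = ?g t" for t by (simp add: distrib_left)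
  have "generic_immersion ?g"
    unfolding generic_immersion_def
    using per C1 nz ns inj by (simp add: double_points_def del: prod.inject)
  then show ?thesis by (simp add: virtual_diagram_def round_circle_def)
qed

end

theory Submission
  imports Defs
begin

text \<open>Let \<open>s\<^sub>0\<close> and \<open>t\<^sub>0\<close> be the parameters of a crossing at which the strand of \<open>s\<^sub>0\<close> is over. A second
  Reidemeister move next to it makes the two strands cross three times in a row, at \<open>x\<^sub>1, x\<^sub>2, x\<^sub>3\<close>,
  with the strand of \<open>s\<^sub>0\<close> over at \<open>x\<^sub>1\<close> and under at \<open>x\<^sub>2\<close> and \<open>x\<^sub>3\<close>. After \<open>x\<^sub>1\<close> and \<open>x\<^sub>2\<close> have been
  welded, a virtual second Reidemeister move removes them. What remains is the single crossing \<open>x\<^sub>3\<close>, of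
  the opposite kind to the original one. So every crossing change can be replaced by two weldings.

  The pictures are drawn in the chart \<open>\<Psi> (x, y) = \<gamma> (s\<^sub>0 + x) + \<gamma> (t\<^sub>0 + y) - \<gamma> s\<^sub>0\<close>, which takes the
  coordinate axes to the two strands.\<close>

text \<open>A move has to be exhibited inside an actual disc of a C1 curve, with equal markings at
  every parameter outside. The deformation is therefore reduced to one real function
  \<open>c\<close>: its fixed points are crossings, slope different from 1 there is transversality,
  and inserting a bigon means passing to a function with two more fixed points on an interval.

  The surviving crossing lies beside the place of the original one, whereas the target diagram has
  the undeformed curve. Instead of an ambient isotopy that moves it back, a second profile with this
  crossing alone serves as an intermediate diagram, so that every step is a classical or virtual
  second Reidemeister move.

  Each replacement changes the diagram on which the remaining switches are pending, and one of its
  two welded crossings did not exist before. The induction hence carries disjoint sets of pending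
  switches and weldings on a varying diagram of the same knot. The growth of the diagram does no
  harm because the welded unknotting number is a minimum over all diagrams.\<close>

lemma interior_injective_image:
  fixes f :: "'a::euclidean_space \<Rightarrow> 'a"
  assumes "continuous_on Q f" "open Q" "inj_on f Q" "B \<subseteq> Q"
  shows "interior (f ` B) = f ` interior B"
proof
  have "open (f ` interior B)"
    using assms interior_subset[of B]
    by (intro invariance_of_domain continuous_on_subset[OF assms(1)] inj_on_subset[OF assms(3)]) auto
  then show "f ` interior B \<subseteq> interior (f ` B)"
    by (intro interior_maximal image_mono interior_subset)
  have "open (Q \<inter> f -` interior (f ` B))"
    by (intro continuous_open_preimage assms open_interior)
  moreover have "Q \<inter> f -` interior (f ` B) \<subseteq> B"
    proof
    fix x assume x: "x \<in> Q \<inter> f -` interior (f ` B)"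
    then obtain y where "y \<in> B" "f x = f y" using interior_subset by fastforce
    then show "x \<in> B" using x assms(3,4) by (metis IntE inj_onD subsetD)
  qed
  ultimately have "Q \<inter> f -` interior (f ` B) \<subseteq> interior B"
    by (rule interior_maximal[rotated])
  then show "interior (f ` B) \<subseteq> f ` interior B"
    using assms(4) interior_subset[of "f ` B"] by blast
qed

text \<open>Only a common neighbourhood of the two points is recorded for \<open>z\<close>, so the
  order of \<open>x\<close> and \<open>y\<close> never has to be known; this is all that the
  determinant estimate for the chart asks for.\<close>

lemma mvt_between:
  fixes f :: "real \<Rightarrow> real"
  assumes "\<And>x. (f has_real_derivative f' x) (at x)" "\<bar>x - a\<bar> < d" "\<bar>y - a\<bar> < d"
  obtains z where "\<bar>z - a\<bar> < d" "f x - f y = (x - y) * f' z"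
proof -
  consider "x < y" | "x = y" | "y < x" by linarith
  then show thesis
  proof cases
    case 1
    obtain z where "x < z" "z < y" "f y - f x = (y - x) * f' z"
      using MVT2[OF 1, of f f'] assms(1) by blast
    then show ?thesis using assms(2,3) by (intro that[of z]) (auto simp: algebra_simps)
  next
    case 2 then show ?thesis using assms by (intro that[of x]) auto
  next
    case 3
    obtain z where "y < z" "z < x" "f x - f y = (x - y) * f' z"
      using MVT2[OF 3, of f f'] assms(1) by blast
    then show ?thesis using assms(2,3) by (intro that[of z]) auto
  qed
qed

section \<open>Generic immersions as periodic C1 curves, and charts at their crossings\<close>

lemma generic_immersion_periodic:
  assumes "generic_immersion \<gamma>"
  shows "\<gamma> (t + of_int n) = \<gamma> t"
proof -
  have 1: "\<gamma> (t + 1) = \<gamma> t" for t using assms by (simp add: generic_immersion_def)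
  have nat: "\<gamma> (t + real k) = \<gamma> t" for t k
  proof (induction k)
    case (Suc k) then show ?case using 1[of "t + real k"] by (simp add: algebra_simps)
  qed simp
  show ?thesis
  proof (cases "n \<ge> 0")
    case True then show ?thesis using nat[of t "nat n"] by simp
  next
    case False then show ?thesis using nat[of "t + of_int n" "nat (- n)"] by simp
  qed
qed

lemma generic_immersion_congruent:
  assumes "generic_immersion \<gamma>" "s - t \<in> \<int>"
  shows "\<gamma> s = \<gamma> t"
proof -
  obtain n :: int where "s - t = of_int n" using assms(2) by (auto elim: Ints_cases)
  then have "s = t + of_int n" by simp
  then show ?thesis using generic_immersion_periodic[OF assms(1)] by simp
qed

lemma generic_immersion_derivative:
  assumes "generic_immersion \<gamma>"
  shows "(\<gamma> has_vector_derivative vector_derivative \<gamma> (at t)) (at t)"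
    and "continuous_on UNIV (\<lambda>t. vector_derivative \<gamma> (at t))"
proof -
  have "\<gamma> C1_differentiable_on UNIV" using assms by (simp add: generic_immersion_def)
  then obtain D where D: "\<And>x. (\<gamma> has_vector_derivative D x) (at x)" "continuous_on UNIV D"
    by (auto simp: C1_differentiable_on_def)
  have "D = (\<lambda>t. vector_derivative \<gamma> (at t))" using vector_derivative_at[OF D(1)] by auto
  then show "(\<gamma> has_vector_derivative vector_derivative \<gamma> (at t)) (at t)"
    "continuous_on UNIV (\<lambda>t. vector_derivative \<gamma> (at t))" using D by auto
qed

lemma generic_immersion_continuous: "generic_immersion \<gamma> \<Longrightarrow> continuous_on S \<gamma>"
  by (meson generic_immersion_derivative(1) continuous_at_imp_continuous_on has_vector_derivative_continuous)

lemma vector_derivative_congruent: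
  assumes "generic_immersion \<gamma>" "s - t \<in> \<int>"
  shows "vector_derivative \<gamma> (at s) = vector_derivative \<gamma> (at t)"
proof -
  have "((\<gamma> \<circ> (\<lambda>x. x + (s - t))) has_vector_derivative 1 *\<^sub>R vector_derivative \<gamma> (at s)) (at t)"
    by (rule vector_diff_chain_at)
       (auto intro!: derivative_eq_intros generic_immersion_derivative(1)[OF assms(1)])
  moreover have "\<gamma> \<circ> (\<lambda>x. x + (s - t)) = \<gamma>"
    using generic_immersion_congruent[OF assms(1)] assms(2) by auto
  ultimately show ?thesis by (simp add: vector_derivative_at)
qed

lemma open_strand_centred: "t \<in> open_strand (a - d, a + d) \<longleftrightarrow> (\<exists>n::int. \<bar>t - a - of_int n\<bar> < d)"
proof -
  have "\<And>n::int. (a - d + of_int n < t \<and> t < a + d + of_int n) = (\<bar>t - a - of_int n\<bar> < d)" by linarith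
  then show ?thesis by (simp add: open_strand_def)
qed

text \<open>\<open>\<delta>\<close> is the half-side of a square on which the chart is injective,
  and \<open>\<epsilon>\<close> is the unit of length of all pictures. They stay within the box of
  half-side \<open>10 * \<epsilon>\<close>, which by \<open>chart_strands\<close> no branch other
  than the two given ones enters. The bound 1/2 on \<open>\<delta>\<close> keeps different integer
  translates of a parameter interval of radius \<open>\<delta>\<close> apart.\<close>

locale crossing_chart =
  fixes \<gamma> :: "real \<Rightarrow> plane" and s\<^sub>0 t\<^sub>0 \<delta> \<epsilon> :: real
  assumes generic: "generic_immersion \<gamma>"
    and crossing: "same_image \<gamma> s\<^sub>0 t\<^sub>0"
    and eps_pos: "0 < \<epsilon>" and eps_delta: "10 * \<epsilon> < \<delta>" and delta_small: "\<delta> < 1/2"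
    and independent: "\<And>x y. \<bar>x\<bar> < \<delta> \<Longrightarrow> \<bar>y\<bar> < \<delta> \<Longrightarrow>
      linearly_independent2 (vector_derivative \<gamma> (at (s\<^sub>0 + x))) (vector_derivative \<gamma> (at (t\<^sub>0 + y)))"
    and chart_inj: "inj_on (\<lambda>(x, y). \<gamma> (s\<^sub>0 + x) + \<gamma> (t\<^sub>0 + y) - \<gamma> s\<^sub>0) ({-\<delta><..<\<delta>} \<times> {-\<delta><..<\<delta>})"
    and chart_strands: "\<And>x y t. \<bar>x\<bar> \<le> 10 * \<epsilon> \<Longrightarrow> \<bar>y\<bar> \<le> 10 * \<epsilon> \<Longrightarrow>
      \<gamma> t = \<gamma> (s\<^sub>0 + x) + \<gamma> (t\<^sub>0 + y) - \<gamma> s\<^sub>0 \<Longrightarrow>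
      (\<exists>n::int. \<bar>t - s\<^sub>0 - of_int n\<bar> < \<delta>) \<or> (\<exists>n::int. \<bar>t - t\<^sub>0 - of_int n\<bar> < \<delta>)"

text \<open>Injectivity is a quantitative inverse function argument: the Jacobian determinant stays
  nonzero near the origin. The other branches are kept away by compactness and the absence of triple
  points.\<close>

lemma crossing_chart_exists:
  assumes gen: "generic_immersion \<gamma>" and si: "same_image \<gamma> s\<^sub>0 t\<^sub>0"
  obtains \<delta> \<epsilon> where "crossing_chart \<gamma> s\<^sub>0 t\<^sub>0 \<delta> \<epsilon>"
proof -
  define g' where "g' t = vector_derivative \<gamma> (at t)" for t
  define \<Psi> where "\<Psi> = (\<lambda>(x, y). \<gamma> (s\<^sub>0 + x) + \<gamma> (t\<^sub>0 + y) - \<gamma> s\<^sub>0)"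
  have der: "(\<gamma> has_vector_derivative g' t) (at t)" for t
    unfolding g'_def by (rule generic_immersion_derivative[OF gen])
  have cont': "continuous_on UNIV g'"
    unfolding g'_def by (rule generic_immersion_derivative[OF gen])
  have cont: "continuous_on UNIV \<gamma>" by (rule generic_immersion_continuous[OF gen])
  have ints: "s\<^sub>0 - t\<^sub>0 \<notin> \<int>" and eq: "\<gamma> s\<^sub>0 = \<gamma> t\<^sub>0" using si by (auto simp: same_image_def)
  \<comment> \<open>Four separate arguments: the mean value theorem yields a different point for each coordinate.\<close>
  define det where "det = (\<lambda>(x\<^sub>1, x\<^sub>2, y\<^sub>1, y\<^sub>2).
     fst (g' (s\<^sub>0 + x\<^sub>1)) * snd (g' (t\<^sub>0 + y\<^sub>2)) - snd (g' (s\<^sub>0 + x\<^sub>2)) * fst (g' (t\<^sub>0 + y\<^sub>1)))"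
  have "continuous_on UNIV det"
    unfolding det_def case_prod_unfold
    by (intro continuous_intros continuous_on_compose2[OF cont']) auto
  then have "open (det -` (- {0}))"
    by (simp add: open_vimage open_Compl)
  moreover have "(0, 0, 0, 0) \<in> det -` (- {0})"
    using gen si by (simp add: det_def generic_immersion_def linearly_independent2_def g'_def)
  ultimately obtain r where r: "r > 0" "ball (0, 0, 0, 0) r \<subseteq> det -` (- {0})"
    using openE by blast
  \<comment> \<open>The norm of a quadruple is at most the sum of its four entries, which explains
    \<open>r / 4\<close>; the second bound gives \<open>\<delta> < 1/2\<close>.\<close>
  define \<delta> where "\<delta> = min (r / 4) (1 / 4)"
  have d: "0 < \<delta>" "\<delta> < 1 / 2" using r by (auto simp: \<delta>_def)
  have det: "fst (g' (s\<^sub>0 + x\<^sub>1)) * snd (g' (t\<^sub>0 + y\<^sub>2)) - snd (g' (s\<^sub>0 + x\<^sub>2)) * fst (g' (t\<^sub>0 + y\<^sub>1)) \<noteq> 0"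
    if "\<bar>x\<^sub>1\<bar> < \<delta>" "\<bar>x\<^sub>2\<bar> < \<delta>" "\<bar>y\<^sub>1\<bar> < \<delta>" "\<bar>y\<^sub>2\<bar> < \<delta>" for x\<^sub>1 x\<^sub>2 y\<^sub>1 y\<^sub>2
  proof -
    have "norm (x\<^sub>1, x\<^sub>2, y\<^sub>1, y\<^sub>2) \<le> norm x\<^sub>1 + (norm x\<^sub>2 + (norm y\<^sub>1 + norm y\<^sub>2))"
      by (meson add_left_mono norm_Pair_le order_trans)
    also have "\<dots> < r" using that by (auto simp: \<delta>_def)
    finally have "(x\<^sub>1, x\<^sub>2, y\<^sub>1, y\<^sub>2) \<in> ball (0, 0, 0, 0) r"
      by (simp add: dist_norm norm_Pair)
    then have "det (x\<^sub>1, x\<^sub>2, y\<^sub>1, y\<^sub>2) \<noteq> 0" using r by blast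
    then show ?thesis by (simp add: det_def)
  qed
  have indep: "linearly_independent2 (g' (s\<^sub>0 + x)) (g' (t\<^sub>0 + y))" if "\<bar>x\<bar> < \<delta>" "\<bar>y\<bar> < \<delta>" for x y
    using det[OF that(1) that(1) that(2) that(2)] by (simp add: linearly_independent2_def)
  have d1: "((\<lambda>t. fst (\<gamma> t)) has_real_derivative fst (g' t)) (at t)"
   and d2: "((\<lambda>t. snd (\<gamma> t)) has_real_derivative snd (g' t)) (at t)" for t
    using bounded_linear.has_vector_derivative[OF bounded_linear_fst der]
      bounded_linear.has_vector_derivative[OF bounded_linear_snd der]
    by (simp_all add: has_real_derivative_iff_has_vector_derivative)
  have inj: "inj_on \<Psi> ({-\<delta><..<\<delta>} \<times> {-\<delta><..<\<delta>})"
  proof (rule inj_onI, clarify)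
    fix x y x' y'
    assume *: "x \<in> {-\<delta><..<\<delta>}" "y \<in> {-\<delta><..<\<delta>}" "x' \<in> {-\<delta><..<\<delta>}" "y' \<in> {-\<delta><..<\<delta>}"
      and E: "\<Psi> (x, y) = \<Psi> (x', y')"
    have abs: "\<bar>(s\<^sub>0 + x) - s\<^sub>0\<bar> < \<delta>" "\<bar>(s\<^sub>0 + x') - s\<^sub>0\<bar> < \<delta>" "\<bar>(t\<^sub>0 + y) - t\<^sub>0\<bar> < \<delta>" "\<bar>(t\<^sub>0 + y') - t\<^sub>0\<bar> < \<delta>"
      using * by auto
    obtain a1 where a1: "\<bar>a1 - s\<^sub>0\<bar> < \<delta>" "fst (\<gamma> (s\<^sub>0 + x)) - fst (\<gamma> (s\<^sub>0 + x')) = (x - x') * fst (g' a1)"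
      using mvt_between[OF d1 abs(1,2)] by auto
    obtain a2 where a2: "\<bar>a2 - s\<^sub>0\<bar> < \<delta>" "snd (\<gamma> (s\<^sub>0 + x)) - snd (\<gamma> (s\<^sub>0 + x')) = (x - x') * snd (g' a2)"
      using mvt_between[OF d2 abs(1,2)] by auto
    obtain b1 where b1: "\<bar>b1 - t\<^sub>0\<bar> < \<delta>" "fst (\<gamma> (t\<^sub>0 + y)) - fst (\<gamma> (t\<^sub>0 + y')) = (y - y') * fst (g' b1)"
      using mvt_between[OF d1 abs(3,4)] by auto
    obtain b2 where b2: "\<bar>b2 - t\<^sub>0\<bar> < \<delta>" "snd (\<gamma> (t\<^sub>0 + y)) - snd (\<gamma> (t\<^sub>0 + y')) = (y - y') * snd (g' b2)"
      using mvt_between[OF d2 abs(3,4)] by auto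
    have E1: "(x - x') * fst (g' a1) + (y - y') * fst (g' b1) = 0"
      and E2: "(x - x') * snd (g' a2) + (y - y') * snd (g' b2) = 0"
      using E unfolding a1(2)[symmetric] a2(2)[symmetric] b1(2)[symmetric] b2(2)[symmetric]
      by (auto simp: \<Psi>_def prod_eq_iff)
    have D: "fst (g' a1) * snd (g' b2) - snd (g' a2) * fst (g' b1) \<noteq> 0"
      using det[OF a1(1) a2(1) b1(1) b2(1)] by simp
    \<comment> \<open>Cramer's rule for the linear system \<open>E1\<close>, \<open>E2\<close> in
      the two unknown differences.\<close>
    have "(x - x') * (fst (g' a1) * snd (g' b2) - snd (g' a2) * fst (g' b1)) = 0"
      "(y - y') * (fst (g' a1) * snd (g' b2) - snd (g' a2) * fst (g' b1)) = 0"
      using E1 E2 by algebra+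
    then show "x = x' \<and> y = y'" using D by auto
  qed
  \<comment> \<open>One period without the neighbourhoods of the two branches is compact. Its image
    misses the crossing, since a third parameter there would be a triple point, and hence misses a
    whole ball around it.\<close>
  define far where "far = {0..1} - open_strand (s\<^sub>0 - \<delta>, s\<^sub>0 + \<delta>) - open_strand (t\<^sub>0 - \<delta>, t\<^sub>0 + \<delta>)"
  have "open (open_strand I)" for I by (auto simp: open_strand_def)
  then have "compact far" unfolding far_def by (intro compact_diff) auto
  then have "closed (\<gamma> ` far)"
    using compact_imp_closed compact_continuous_image[OF continuous_on_subset[OF cont]] by blast
  moreover have "\<gamma> s\<^sub>0 \<notin> \<gamma> ` far"
  proof
    assume "\<gamma> s\<^sub>0 \<in> \<gamma> ` far"
    then obtain t where t: "t \<in> far" "\<gamma> s\<^sub>0 = \<gamma> t" by auto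
    then have "t - s\<^sub>0 \<in> \<int> \<or> t - t\<^sub>0 \<in> \<int>"
      using gen eq ints unfolding generic_immersion_def by metis
    then obtain n :: int where "t - s\<^sub>0 = of_int n \<or> t - t\<^sub>0 = of_int n"
      by (auto elim: Ints_cases)
    then have "\<bar>t - s\<^sub>0 - of_int n\<bar> < \<delta> \<or> \<bar>t - t\<^sub>0 - of_int n\<bar> < \<delta>"
      using d by auto
    then show False
      using t(1) by (auto simp: far_def open_strand_centred)
  qed
  ultimately obtain \<rho> where \<rho>: "\<rho> > 0" "ball (\<gamma> s\<^sub>0) \<rho> \<subseteq> - \<gamma> ` far"
    by (metis ComplI open_Compl openE)
  have "continuous_on UNIV \<Psi>"
    unfolding \<Psi>_def case_prod_unfold
    by (intro continuous_intros continuous_on_compose2[OF cont]) auto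
  then have "open (\<Psi> -` ball (\<gamma> s\<^sub>0) \<rho>)" by (simp add: open_vimage)
  moreover have "(0, 0) \<in> \<Psi> -` ball (\<gamma> s\<^sub>0) \<rho>" using \<rho>(1) eq by (simp add: \<Psi>_def)
  ultimately obtain e where e: "e > 0" "ball (0, 0) e \<subseteq> \<Psi> -` ball (\<gamma> s\<^sub>0) \<rho>"
    using openE by blast
  \<comment> \<open>A point of the box of half-side \<open>10 * \<epsilon>\<close> has norm at most
    \<open>20 * \<epsilon>\<close>, which must be less than \<open>e\<close>; also
    \<open>10 * \<epsilon> < \<delta>\<close> is required. Division by 30 gives both.\<close>
  define \<epsilon> where "\<epsilon> = min e \<delta> / 30"
  have eps: "0 < \<epsilon>" "10 * \<epsilon> < \<delta>" "20 * \<epsilon> < e" using d e by (auto simp: \<epsilon>_def)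
  have strands: "(\<exists>n::int. \<bar>t - s\<^sub>0 - of_int n\<bar> < \<delta>) \<or> (\<exists>n::int. \<bar>t - t\<^sub>0 - of_int n\<bar> < \<delta>)"
    if xy: "\<bar>x\<bar> \<le> 10 * \<epsilon>" "\<bar>y\<bar> \<le> 10 * \<epsilon>" and t: "\<gamma> t = \<Psi> (x, y)" for x y t
  proof -
    have "norm (x, y) < e" using norm_Pair_le[of x y] xy eps by simp
    then have "(x, y) \<in> ball (0, 0) e" by (simp add: dist_norm norm_Pair)
    then have "\<Psi> (x, y) \<in> ball (\<gamma> s\<^sub>0) \<rho>" using e(2) by blast
    moreover have "\<gamma> (frac t) = \<gamma> t"
      by (intro generic_immersion_congruent[OF gen]) (simp add: frac_def)
    ultimately have "frac t \<notin> far" using \<rho>(2) t by (metis ComplD imageI subsetD)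
    then obtain n :: int where "\<bar>frac t - s\<^sub>0 - of_int n\<bar> < \<delta> \<or> \<bar>frac t - t\<^sub>0 - of_int n\<bar> < \<delta>"
      using frac_lt_1[of t] frac_ge_0[of t] by (auto simp: far_def open_strand_centred)
    then have "\<bar>t - s\<^sub>0 - of_int (\<lfloor>t\<rfloor> + n)\<bar> < \<delta> \<or> \<bar>t - t\<^sub>0 - of_int (\<lfloor>t\<rfloor> + n)\<bar> < \<delta>"
      by (simp add: frac_def algebra_simps)
    then show ?thesis by blast
  qed
  have "crossing_chart \<gamma> s\<^sub>0 t\<^sub>0 \<delta> \<epsilon>"
    using gen si eps d indep inj strands by unfold_locales (auto simp: g'_def \<Psi>_def)
  then show ?thesis by (rule that)
qed

section \<open>Periodic bumps\<close>

text \<open>The fundamental period is centred at 0, so that a bump supported near 0 is not cut by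
  its ends.\<close>

definition periodic_extension :: "(real \<Rightarrow> real) \<Rightarrow> real \<Rightarrow> real" where
  "periodic_extension c t = c (frac (t + 1/2) - 1/2)"

lemma periodic_extension_shift:
  assumes "\<bar>x\<bar> < 1/2"
  shows "periodic_extension c (x + of_int n) = c x"
proof -
  have "frac (x + of_int n + 1/2) = x + 1/2"
    using assms by (subst frac_unique_iff) (auto simp: abs_less_iff)
  then show ?thesis by (simp add: periodic_extension_def)
qed

lemma periodic_extension_periodic: "periodic_extension c (t + 1) = periodic_extension c t"
proof -
  have "\<lfloor>t + 1 + 1/2\<rfloor> = \<lfloor>t + 1/2\<rfloor> + 1" by linarith
  then show ?thesis by (simp add: periodic_extension_def frac_def)
qed

lemma periodic_extension_cases:
  obtains x n where "\<bar>x\<bar> \<le> 1/2" "t = x + of_int n" "periodic_extension c t = c x"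
proof
  show "\<bar>frac (t + 1/2) - 1/2\<bar> \<le> 1/2"
    using frac_ge_0[of "t + 1/2"] frac_lt_1[of "t + 1/2"] by linarith
  show "t = frac (t + 1/2) - 1/2 + of_int \<lfloor>t + 1/2\<rfloor>" by (simp add: frac_def)
qed (simp add: periodic_extension_def)

text \<open>The translate is chosen by \<open>t\<close>, not by \<open>u\<close>. Where the two
  choices differ, both arguments of \<open>c\<close> have absolute value at least 3/8, so both
  values vanish. This covers the points where the floor function jumps.\<close>

lemma periodic_extension_local:
  assumes supp: "\<And>x. 3/8 \<le> \<bar>x\<bar> \<Longrightarrow> c x = 0" and u: "\<bar>u - t\<bar> < 1/8"
  shows "periodic_extension c u = c (u - of_int \<lfloor>t + 1/2\<rfloor>)"
proof -
  obtain x and n :: int where x: "\<bar>x\<bar> \<le> 1/2" "u = x + of_int n" "periodic_extension c u = c x"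
    by (rule periodic_extension_cases)
  show ?thesis
  proof (cases "n = \<lfloor>t + 1/2\<rfloor>")
    case True then show ?thesis using x by simp
  next
    case False
    define m where "m = \<lfloor>t + 1/2\<rfloor>"
    have m: "of_int m \<le> t + 1/2" "t + 1/2 < of_int m + 1"
      unfolding m_def by linarith+
    have "n \<le> m - 1 \<or> n \<ge> m + 1" using False m_def by linarith
    then have "(of_int n :: real) \<le> of_int m - 1 \<or> (of_int n :: real) \<ge> of_int m + 1"
      by linarith
    then have "3/8 \<le> \<bar>x\<bar>" "3/8 \<le> \<bar>u - of_int m\<bar>" using m u x(1,2) by linarith+
    then show ?thesis using x(3) supp by (simp add: m_def)
  qed
qed

lemma periodic_extension_C1:
  assumes der: "\<And>x. (c has_real_derivative c' x) (at x)" and cont: "continuous_on UNIV c'"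
    and supp: "\<And>x. 3/8 \<le> \<bar>x\<bar> \<Longrightarrow> c x = 0 \<and> c' x = 0"
  shows "(periodic_extension c has_real_derivative periodic_extension c' t) (at t)"
    and "continuous_on UNIV (periodic_extension c')"
proof -
  define n where "n t = \<lfloor>t + 1/2 :: real\<rfloor>" for t
  have ev: "\<forall>\<^sub>F u in nhds t. \<bar>u - t\<bar> < 1/8" for t :: real
    by (intro eventually_nhds_metric[THEN iffD2] exI[of _ "1/8"]) (auto simp: dist_real_def)
  have c: "\<forall>\<^sub>F u in nhds t. periodic_extension c u = c (u - of_int (n t))"
   and c': "\<forall>\<^sub>F u in nhds t. periodic_extension c' u = c' (u - of_int (n t))" for t
    by (use ev[of t] in eventually_elim, simp add: periodic_extension_local[OF _ _] supp n_def)+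
  have "((\<lambda>u. c (u - of_int (n t))) has_real_derivative c' (t - of_int (n t)) * 1) (at t)"
    by (rule DERIV_chain2[OF der]) (auto intro!: derivative_eq_intros)
  moreover have "c' (t - of_int (n t)) = periodic_extension c' t"
    using eventually_nhds_x_imp_x[OF c'[of t]] by simp
  ultimately show "(periodic_extension c has_real_derivative periodic_extension c' t) (at t)"
    by (simp add: DERIV_cong_ev[OF refl c refl])
  have "isCont (\<lambda>u. c' (u - of_int (n t))) t" for t
    using cont by (auto intro!: continuous_intros isCont_o2[of t _ c'] simp: continuous_on_eq_continuous_at)
  then show "continuous_on UNIV (periodic_extension c')"
    using isCont_cong[OF c'] by (simp add: continuous_on_eq_continuous_at)
qed

section \<open>Deforming a strand near a crossing\<close>

lemma same_image_sym: "same_image g t u \<Longrightarrow> same_image g u t"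
  unfolding same_image_def using minus_in_Ints_iff[of "t - u"] by (simp add: eq_commute)

context crossing_chart
begin

definition \<Psi> :: "real \<times> real \<Rightarrow> plane" where
  "\<Psi> = (\<lambda>(x, y). \<gamma> (s\<^sub>0 + x) + \<gamma> (t\<^sub>0 + y) - \<gamma> s\<^sub>0)"

text \<open>At the parameter \<open>s\<^sub>0 + x\<close> the deformed curve is at \<open>\<Psi> (x - c x, c x)\<close>. It meets the second
  strand there iff \<open>c x = x\<close>, and then at the parameter \<open>t\<^sub>0 + x\<close>.\<close>

definition bumped :: "(real \<Rightarrow> real) \<Rightarrow> real \<Rightarrow> plane" where
  "bumped c t = \<Psi> (t - s\<^sub>0 - periodic_extension c (t - s\<^sub>0), periodic_extension c (t - s\<^sub>0))"

lemma crossing_not_int: "s\<^sub>0 - t\<^sub>0 \<notin> \<int>" and crossing_eq: "\<gamma> t\<^sub>0 = \<gamma> s\<^sub>0"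
  using crossing by (auto simp: same_image_def)

lemma congruent: "s - t \<in> \<int> \<Longrightarrow> \<gamma> s = \<gamma> t"
  by (rule generic_immersion_congruent[OF generic])

lemma periodic: "\<gamma> (t + of_int n) = \<gamma> t"
  by (rule generic_immersion_periodic[OF generic])

lemma chart_eqD:
  assumes "\<Psi> (x, y) = \<Psi> (x', y')" "\<bar>x\<bar> < \<delta>" "\<bar>y\<bar> < \<delta>" "\<bar>x'\<bar> < \<delta>" "\<bar>y'\<bar> < \<delta>"
  shows "x = x' \<and> y = y'"
  using inj_onD[OF chart_inj, of "(x, y)" "(x', y')"] assms by (auto simp: \<Psi>_def abs_less_iff)

lemma chart_axes: "\<Psi> (x, 0) = \<gamma> (s\<^sub>0 + x)" "\<Psi> (0, y) = \<gamma> (t\<^sub>0 + y)"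
  by (simp_all add: \<Psi>_def crossing_eq)

text \<open>A common parameter would yield a common point of the two coordinate axes, hence the
  origin, whose two parameters are not congruent.\<close>

lemma strands_disjoint:
  assumes "\<bar>x\<bar> < \<delta>" "\<bar>y\<bar> < \<delta>"
  shows "s\<^sub>0 + x - (t\<^sub>0 + y) \<notin> \<int>"
proof
  assume "s\<^sub>0 + x - (t\<^sub>0 + y) \<in> \<int>"
  then have "\<Psi> (x, 0) = \<Psi> (0, y)" unfolding chart_axes by (rule congruent)
  then have "x = 0" "y = 0" using chart_eqD[of x 0 0 y] assms by auto
  then show False using \<open>s\<^sub>0 + x - (t\<^sub>0 + y) \<in> \<int>\<close> crossing_not_int by simp
qed

lemma near_strand_cases:
  obtains (I) x n where "\<bar>x\<bar> < \<delta>" "t = s\<^sub>0 + x + of_int n"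
  | (J) y n where "\<bar>y\<bar> < \<delta>" "t = t\<^sub>0 + y + of_int n"
  | (far) "\<And>x y. \<bar>x\<bar> \<le> 10 * \<epsilon> \<Longrightarrow> \<bar>y\<bar> \<le> 10 * \<epsilon> \<Longrightarrow> \<gamma> t \<noteq> \<Psi> (x, y)"
    "\<And>n::int. \<delta> \<le> \<bar>t - s\<^sub>0 - of_int n\<bar>"
proof -
  consider n :: int where "\<bar>t - s\<^sub>0 - of_int n\<bar> < \<delta>" | n :: int where "\<bar>t - t\<^sub>0 - of_int n\<bar> < \<delta>"
    | "\<And>n::int. \<not> \<bar>t - s\<^sub>0 - of_int n\<bar> < \<delta>" "\<And>n::int. \<not> \<bar>t - t\<^sub>0 - of_int n\<bar> < \<delta>"
    by blast
  then show thesis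
  proof cases
    case (1 n) then show ?thesis using I[of "t - s\<^sub>0 - of_int n" n] by simp
  next
    case (2 n) then show ?thesis using J[of "t - t\<^sub>0 - of_int n" n] by simp
  next
    case 3
    show ?thesis
    proof (rule far)
      show "\<gamma> t \<noteq> \<Psi> (x, y)" if "\<bar>x\<bar> \<le> 10 * \<epsilon>" "\<bar>y\<bar> \<le> 10 * \<epsilon>" for x y
        using chart_strands[OF that, of t] 3 by (auto simp: \<Psi>_def)
      show "\<delta> \<le> \<bar>t - s\<^sub>0 - of_int n\<bar>" for n
        using 3(1)[of n] by simp
    qed
  qed
qed

text \<open>Inside the box the curve consists of the two axes only; each parameter on them is
  recovered from the coordinates by injectivity of the chart.\<close>

lemma chart_box_preimage:
  assumes "\<bar>x\<bar> \<le> 10 * \<epsilon>" "\<bar>y\<bar> \<le> 10 * \<epsilon>" "\<gamma> t = \<Psi> (x, y)"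
  shows "(\<exists>n. t = s\<^sub>0 + x + of_int n \<and> y = 0) \<or> (\<exists>n. t = t\<^sub>0 + y + of_int n \<and> x = 0)"
proof -
  have xy: "\<bar>x\<bar> < \<delta>" "\<bar>y\<bar> < \<delta>" using assms eps_delta by auto
  show ?thesis
  proof (cases t rule: near_strand_cases)
    case (I z n)
    then have "\<Psi> (z, 0) = \<Psi> (x, y)" using assms periodic[of "s\<^sub>0 + z"] by (simp add: chart_axes)
    then show ?thesis using chart_eqD[of z 0 x y] xy I by auto
  next
    case (J z n)
    then have "\<Psi> (0, z) = \<Psi> (x, y)" using assms periodic[of "t\<^sub>0 + z"] by (simp add: chart_axes)
    then show ?thesis using chart_eqD[of 0 z x y] xy J by auto
  qed (use assms in auto)
qed

lemma chart_double_point: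
  assumes "\<bar>x\<bar> \<le> 10 * \<epsilon>" "\<bar>y\<bar> \<le> 10 * \<epsilon>" "\<gamma> t = \<Psi> (x, y)" "same_image \<gamma> t u"
  shows "x = 0 \<and> y = 0"
proof -
  have tu: "t - u \<notin> \<int>" and u: "\<gamma> u = \<Psi> (x, y)" using assms by (auto simp: same_image_def)
  have False if "t = a + of_int m" "u = a + of_int n" for a m n
    using tu that by (metis Ints_diff Ints_of_int add_diff_cancel_left)
  then show ?thesis
    using chart_box_preimage[OF assms(1,2,3)] chart_box_preimage[OF assms(1,2) u] by blast
qed

text \<open>The width \<open>4 * \<epsilon>\<close> is that of the later bumps: every double point
  other than the charted one has its parameters outside their support and is left in place.\<close>

lemma far_if_double_point:
  assumes "same_image \<gamma> t u" "\<gamma> t \<noteq> \<gamma> s\<^sub>0"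
  shows "4 * \<epsilon> \<le> \<bar>t - s\<^sub>0 - of_int n\<bar>"
proof (rule ccontr)
  define x where "x = t - s\<^sub>0 - of_int n"
  assume "\<not> ?thesis"
  then have x: "\<bar>x\<bar> \<le> 10 * \<epsilon>" "t = s\<^sub>0 + x + of_int n" using eps_pos by (auto simp: x_def)
  have "\<gamma> t = \<Psi> (x, 0)" unfolding chart_axes x(2) by (rule periodic)
  then show False using chart_double_point[of x 0 t u] x(1) assms eps_pos by (auto simp: chart_axes)
qed

end

text \<open>In the chart the deformed strand has velocity \<open>(1 - c', c')\<close> and the second
  strand \<open>(0, 1)\<close>, so transversality at a fixed point is
  \<open>c' x \<noteq> 1\<close>. Support radius \<open>4 * \<epsilon>\<close> and height
  \<open>6 * \<epsilon>\<close> add up to the half-side \<open>10 * \<epsilon>\<close> of the free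
  box.\<close>

locale chart_bump = crossing_chart +
  fixes c c' :: "real \<Rightarrow> real"
  assumes bump_deriv: "\<And>x. (c has_real_derivative c' x) (at x)"
    and bump_deriv_cont: "continuous_on UNIV c'"
    and bump_support: "\<And>x. 4 * \<epsilon> \<le> \<bar>x\<bar> \<Longrightarrow> c x = 0 \<and> c' x = 0"
    and bump_bound: "\<And>x. \<bar>c x\<bar> \<le> 6 * \<epsilon>"
    and finite_fixpoints: "finite {x. c x = x}"
    and fixpoint_deriv: "\<And>x. c x = x \<Longrightarrow> c' x \<noteq> 1"
begin

lemma fixpoint_small: "c x = x \<Longrightarrow> \<bar>x\<bar> < 4 * \<epsilon>"
  using bump_support[of x] eps_pos by (cases "4 * \<epsilon> \<le> \<bar>x\<bar>") auto

lemma bump_range: "\<bar>c x\<bar> < \<delta>" and bump_range': "\<bar>x\<bar> < \<delta> \<Longrightarrow> \<bar>x - c x\<bar> < \<delta>"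
proof -
  show "\<bar>c x\<bar> < \<delta>" using bump_bound[of x] eps_delta eps_pos by linarith
  show "\<bar>x - c x\<bar> < \<delta>" if "\<bar>x\<bar> < \<delta>"
    using that bump_bound[of x] bump_support[of x] eps_delta by (cases "4 * \<epsilon> \<le> \<bar>x\<bar>") auto
qed

lemma bumped_I:
  assumes "\<bar>x\<bar> < \<delta>"
  shows "bumped c (s\<^sub>0 + x + of_int n) = \<Psi> (x - c x, c x)"
proof -
  have "periodic_extension c (x + of_int n) = c x"
    using assms delta_small by (intro periodic_extension_shift) simp
  then have "bumped c (s\<^sub>0 + x + of_int n) = \<Psi> (x - c x + of_int n, c x)"
    by (simp add: bumped_def algebra_simps)
  also have "\<dots> = \<Psi> (x - c x, c x)"
    using periodic[of "s\<^sub>0 + (x - c x)" n] by (simp add: \<Psi>_def algebra_simps)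
  finally show ?thesis .
qed

lemma extension_far:
  assumes "\<And>n::int. 4 * \<epsilon> \<le> \<bar>t - s\<^sub>0 - of_int n\<bar>"
  shows "periodic_extension c (t - s\<^sub>0) = 0" "periodic_extension c' (t - s\<^sub>0) = 0"
proof -
  obtain x and n :: int where "t - s\<^sub>0 = x + of_int n" "periodic_extension c (t - s\<^sub>0) = c x"
    by (rule periodic_extension_cases)
  then show "periodic_extension c (t - s\<^sub>0) = 0" using assms[of n] bump_support[of x] by simp
  obtain x and n :: int where "t - s\<^sub>0 = x + of_int n" "periodic_extension c' (t - s\<^sub>0) = c' x"
    by (rule periodic_extension_cases)
  then show "periodic_extension c' (t - s\<^sub>0) = 0" using assms[of n] bump_support[of x] by simp
qed

lemma bumped_far:
  assumes "\<And>n::int. 4 * \<epsilon> \<le> \<bar>t - s\<^sub>0 - of_int n\<bar>"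
  shows "bumped c t = \<gamma> t"
  using extension_far(1)[OF assms] by (simp add: bumped_def \<Psi>_def crossing_eq)

text \<open>The support of the bump contains no parameter of the second strand, which therefore
  stays a straight axis of the chart.\<close>

lemma J_far:
  assumes "\<bar>y\<bar> < \<delta>"
  shows "4 * \<epsilon> \<le> \<bar>t\<^sub>0 + y + of_int m - s\<^sub>0 - of_int n\<bar>"
proof (rule ccontr)
  define x where "x = t\<^sub>0 + y + of_int m - s\<^sub>0 - of_int n"
  assume "\<not> ?thesis"
  then have "\<bar>x\<bar> < \<delta>" using eps_delta eps_pos by (simp add: x_def)
  moreover have "s\<^sub>0 + x - (t\<^sub>0 + y) = of_int (m - n)" by (simp add: x_def)
  then have "s\<^sub>0 + x - (t\<^sub>0 + y) \<in> \<int>" by (metis Ints_of_int)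
  ultimately show False using strands_disjoint assms by blast
qed

lemma bumped_J: "\<bar>y\<bar> < \<delta> \<Longrightarrow> bumped c (t\<^sub>0 + y + of_int n) = \<Psi> (0, y)"
  using bumped_far[OF J_far, of y n] periodic[of "t\<^sub>0 + y" n] by (simp add: chart_axes)

text \<open>This is the complete picture in the box: the deformed arc, the second axis and nothing
  else, because the branches of the \<open>far\<close> case are unchanged and avoid the box.\<close>

lemma bumped_eq_chart_iff:
  assumes "\<bar>x\<bar> \<le> 10 * \<epsilon>" "\<bar>y\<bar> \<le> 10 * \<epsilon>"
  shows "bumped c t = \<Psi> (x, y) \<longleftrightarrow>
    (\<exists>z n. \<bar>z\<bar> < \<delta> \<and> t = s\<^sub>0 + z + of_int n \<and> x = z - c z \<and> y = c z) \<or>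
    (\<exists>n. t = t\<^sub>0 + y + of_int n \<and> x = 0)" (is "_ \<longleftrightarrow> ?R")
proof
  have xy: "\<bar>x\<bar> < \<delta>" "\<bar>y\<bar> < \<delta>" using assms eps_delta by auto
  show "bumped c t = \<Psi> (x, y)" if ?R
    using that bumped_I bumped_J[OF xy(2)] by auto
  assume E: "bumped c t = \<Psi> (x, y)"
  show ?R
  proof (cases t rule: near_strand_cases)
    case (I z n)
    then have "\<Psi> (z - c z, c z) = \<Psi> (x, y)" using E bumped_I by simp
    then have "x = z - c z \<and> y = c z" using chart_eqD[of "z - c z" "c z" x y] xy bump_range bump_range' I by auto
    then show ?thesis using I by blast
  next
    case (J z n)
    then have "\<Psi> (0, z) = \<Psi> (x, y)" using E bumped_J by simp
    then have "x = 0 \<and> y = z" using chart_eqD[of 0 z x y] xy J by auto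
    then show ?thesis using J by blast
  next
    case far
    have "bumped c t = \<gamma> t"
    proof (rule bumped_far)
      show "4 * \<epsilon> \<le> \<bar>t - s\<^sub>0 - of_int n\<bar>" for n
        using far(2)[of n] eps_delta eps_pos by linarith
    qed
    then show ?thesis using far(1)[OF assms] E by simp
  qed
qed

lemma bumped_cases:
  obtains (I) x n where "\<bar>x\<bar> < 4 * \<epsilon>" "t = s\<^sub>0 + x + of_int n" "bumped c t = \<Psi> (x - c x, c x)"
    "\<bar>x - c x\<bar> \<le> 10 * \<epsilon>" "\<bar>c x\<bar> \<le> 10 * \<epsilon>"
  | (far) "\<And>n::int. 4 * \<epsilon> \<le> \<bar>t - s\<^sub>0 - of_int n\<bar>" "bumped c t = \<gamma> t"
proof (cases "\<exists>n::int. \<bar>t - s\<^sub>0 - of_int n\<bar> < 4 * \<epsilon>")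
  case True
  then obtain n :: int where n: "\<bar>t - s\<^sub>0 - of_int n\<bar> < 4 * \<epsilon>" by blast
  define x where "x = t - s\<^sub>0 - of_int n"
  have x: "\<bar>x\<bar> < 4 * \<epsilon>" "t = s\<^sub>0 + x + of_int n" using n by (simp_all add: x_def)
  moreover have "\<bar>x\<bar> < \<delta>" using x(1) eps_delta eps_pos by linarith
  ultimately show ?thesis using bump_bound[of x] bumped_I[of x n] eps_pos by (intro I) auto
next
  case False
  then have "\<And>n::int. 4 * \<epsilon> \<le> \<bar>t - s\<^sub>0 - of_int n\<bar>" by (meson not_less)
  then show ?thesis using bumped_far by (intro far) auto
qed

text \<open>A point of the box determines the parameter on either strand: it is \<open>x + y\<close>
  on the deformed one and \<open>y\<close> on the axis. So coincidences there involve both strands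
  and occur at fixed points of \<open>c\<close>. Outside the box both parameters are at their old
  positions.\<close>

lemma same_image_bumped:
  "same_image (bumped c) t u \<longleftrightarrow> same_image \<gamma> t u \<and> \<gamma> t \<noteq> \<gamma> s\<^sub>0 \<or>
     (\<exists>x. c x = x \<and> (t - (s\<^sub>0 + x) \<in> \<int> \<and> u - (t\<^sub>0 + x) \<in> \<int> \<or> u - (s\<^sub>0 + x) \<in> \<int> \<and> t - (t\<^sub>0 + x) \<in> \<int>))"
  (is "_ \<longleftrightarrow> ?far \<or> ?near")
proof
  assume S: "same_image (bumped c) t u"
  then have tu: "t - u \<notin> \<int>" "bumped c t = bumped c u" by (auto simp: same_image_def)
  show "?far \<or> ?near"
  proof (cases "\<exists>x y. \<bar>x\<bar> \<le> 10 * \<epsilon> \<and> \<bar>y\<bar> \<le> 10 * \<epsilon> \<and> bumped c t = \<Psi> (x, y)")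
    case True
    then obtain x y where xy: "\<bar>x\<bar> \<le> 10 * \<epsilon>" "\<bar>y\<bar> \<le> 10 * \<epsilon>" "bumped c t = \<Psi> (x, y)" by blast
    have u: "bumped c u = \<Psi> (x, y)" using xy(3) tu by simp
    note T = bumped_eq_chart_iff[OF xy(1,2), THEN iffD1]
    from T[OF xy(3)] T[OF u] show ?thesis
    proof (elim disjE exE conjE)
      fix z n z' n' assume *: "t = s\<^sub>0 + z + real_of_int n" "x = z - c z" "y = c z"
        "u = s\<^sub>0 + z' + real_of_int n'" "x = z' - c z'" "y = c z'"
      then have "t - u = of_int (n - n')" by simp
      then show ?thesis using tu(1) by (metis Ints_of_int)
    next
      fix n n' assume "t = t\<^sub>0 + y + real_of_int n" "u = t\<^sub>0 + y + real_of_int n'"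
      then have "t - u = of_int (n - n')" by simp
      then show ?thesis using tu(1) by (metis Ints_of_int)
    next
      fix z n n' assume *: "t = s\<^sub>0 + z + real_of_int n" "x = z - c z" "y = c z"
        "u = t\<^sub>0 + y + real_of_int n'" "x = 0"
      then show ?thesis by (intro disjI2 exI[of _ z]) auto
    next
      fix z n n' assume *: "u = s\<^sub>0 + z + real_of_int n" "x = z - c z" "y = c z"
        "t = t\<^sub>0 + y + real_of_int n'" "x = 0"
      then show ?thesis by (intro disjI2 exI[of _ z]) auto
    qed
  next
    case False
    then have "bumped c t = \<gamma> t" by (cases t rule: bumped_cases) auto
    moreover have "bumped c u = \<gamma> u" using False tu(2) by (cases u rule: bumped_cases) auto
    moreover have "\<gamma> s\<^sub>0 = \<Psi> (0, 0)" by (simp add: chart_axes)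
    then have "\<gamma> t \<noteq> \<gamma> s\<^sub>0" using False \<open>bumped c t = \<gamma> t\<close> eps_pos by auto
    ultimately show ?thesis using tu by (auto simp: same_image_def)
  qed
next
  assume "?far \<or> ?near"
  then show "same_image (bumped c) t u"
  proof
    assume f: ?far
    then have "bumped c t = \<gamma> t" by (intro bumped_far far_if_double_point) auto
    moreover have "same_image \<gamma> u t" "\<gamma> u \<noteq> \<gamma> s\<^sub>0"
      using f by (blast intro: same_image_sym, auto simp: same_image_def)
    then have "bumped c u = \<gamma> u" by (intro bumped_far far_if_double_point)
    ultimately show ?thesis using f by (simp add: same_image_def)
  next
    assume ?near
    then obtain x where x: "c x = x" and
      *: "t - (s\<^sub>0 + x) \<in> \<int> \<and> u - (t\<^sub>0 + x) \<in> \<int> \<or> u - (s\<^sub>0 + x) \<in> \<int> \<and> t - (t\<^sub>0 + x) \<in> \<int>" by blast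
    have xd: "\<bar>x\<bar> < \<delta>" using bump_range[of x] x by simp
    have main: "same_image (bumped c) t u" if tu: "t - (s\<^sub>0 + x) \<in> \<int>" "u - (t\<^sub>0 + x) \<in> \<int>" for t u
    proof -
      obtain m n where "t - (s\<^sub>0 + x) = of_int m" "u - (t\<^sub>0 + x) = of_int n"
        using tu by (auto elim!: Ints_cases)
      then have mn: "t = s\<^sub>0 + x + of_int m" "u = t\<^sub>0 + x + of_int n" by linarith+
      have "t - u \<notin> \<int>"
      proof
        assume "t - u \<in> \<int>"
        then have "t - u - (t - (s\<^sub>0 + x)) + (u - (t\<^sub>0 + x)) \<in> \<int>" using \<open>t - u \<in> \<int>\<close> tu
          by (blast intro: Ints_add Ints_diff)
        then show False using crossing_not_int by simp
      qed
      then show ?thesis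
        unfolding same_image_def using bumped_I[OF xd, of m] bumped_J[OF xd, of n] x mn by simp
    qed
    from * show ?thesis using main same_image_sym by blast
  qed
qed

end

context chart_bump
begin

lemma generic_immersion_bumped: "generic_immersion (bumped c)"
proof -
  define g' where "g' t = vector_derivative \<gamma> (at t)" for t
  define e where "e t = periodic_extension c (t - s\<^sub>0)" for t
  define e' where "e' t = periodic_extension c' (t - s\<^sub>0)" for t
  \<comment> \<open>The chain rule applied to the two summands of the chart.\<close>
  define D where "D t = (1 - e' t) *\<^sub>R g' (t - e t) + e' t *\<^sub>R g' (t\<^sub>0 + e t)" for t
  have g: "(\<gamma> has_vector_derivative g' t) (at t)" for t
    unfolding g'_def by (rule generic_immersion_derivative[OF generic])
  have g'_cont: "continuous_on UNIV g'"
    unfolding g'_def by (rule generic_immersion_derivative[OF generic])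
  have g'_congruent: "g' s = g' t" if "s - t \<in> \<int>" for s t
    unfolding g'_def using that by (rule vector_derivative_congruent[OF generic])
  have g'_nz: "g' t \<noteq> 0" for t using generic by (simp add: g'_def generic_immersion_def)
  have supp: "c x = 0 \<and> c' x = 0" if "3/8 \<le> \<bar>x\<bar>" for x
    using that eps_delta delta_small by (intro bump_support) simp
  note C1 = periodic_extension_C1[OF bump_deriv bump_deriv_cont supp]
  have e: "(e has_real_derivative e' t) (at t)" for t
    unfolding e_def e'_def
    by (rule DERIV_cong[OF DERIV_chain2[OF C1(1)]]) (auto intro!: derivative_eq_intros)
  have e'_cont: "continuous_on UNIV e'"
    unfolding e'_def by (intro continuous_on_compose2[OF C1(2)] continuous_intros) auto
  have e_cont: "continuous_on UNIV e"
    using e by (meson DERIV_isCont continuous_at_imp_continuous_on)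
  have bumped: "bumped c t = \<gamma> (t - e t) + \<gamma> (t\<^sub>0 + e t) - \<gamma> s\<^sub>0" for t
    by (simp add: bumped_def \<Psi>_def e_def)
  have der: "(bumped c has_vector_derivative D t) (at t)" for t
  proof -
    have "((\<lambda>t. t - e t) has_vector_derivative 1 - e' t) (at t)"
      "((\<lambda>t. t\<^sub>0 + e t) has_vector_derivative e' t) (at t)"
      using e[of t] unfolding has_real_derivative_iff_has_vector_derivative[symmetric]
      by (auto intro!: derivative_eq_intros)
    note 1 = vector_diff_chain_at[OF this(1) g] and 2 = vector_diff_chain_at[OF this(2) g]
    have "((\<lambda>t. \<gamma> (t - e t) + \<gamma> (t\<^sub>0 + e t) - \<gamma> s\<^sub>0) has_vector_derivative D t) (at t)"
      using has_vector_derivative_diff[OF has_vector_derivative_add[OF 1 2] has_vector_derivative_const[of "\<gamma> s\<^sub>0"]]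
      by (simp add: D_def o_def)
    then show ?thesis by (simp add: bumped[abs_def])
  qed
  have vd: "vector_derivative (bumped c) (at t) = D t" for t by (rule vector_derivative_at[OF der])
  have "continuous_on UNIV D"
    unfolding D_def
    by (intro continuous_intros e_cont e'_cont continuous_on_compose2[OF g'_cont]) auto
  with der have "bumped c C1_differentiable_on UNIV" by (auto simp: C1_differentiable_on_def)
  \<comment> \<open>If \<open>e' t\<close> is nonzero, then \<open>t\<close> is in the support of
    the bump, where the two vectors combined in \<open>D t\<close> are independent.\<close>
  moreover have "D t \<noteq> 0" for t
  proof (cases "e' t = 0")
    case True then show ?thesis using g'_nz by (simp add: D_def)
  next
    case False
    then obtain n :: int where n: "\<bar>t - s\<^sub>0 - of_int n\<bar> < 4 * \<epsilon>"
      using extension_far(2)[of t] by (metis e'_def not_less)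
    define x where "x = t - s\<^sub>0 - of_int n"
    have x: "\<bar>x\<bar> < \<delta>" using n eps_delta eps_pos by (simp add: x_def)
    have "e t = c x"
      using periodic_extension_shift[of x c n] x delta_small by (simp add: e_def x_def)
    then have "t - e t - (s\<^sub>0 + (x - c x)) = of_int n" by (simp add: x_def)
    then have "g' (t - e t) = g' (s\<^sub>0 + (x - c x))" by (intro g'_congruent) (metis Ints_of_int)
    then have "linearly_independent2 (g' (t - e t)) (g' (t\<^sub>0 + e t))"
      using independent[OF bump_range'[OF x] bump_range[of x]] \<open>e t = c x\<close> by (simp add: g'_def)
    moreover have "\<not> linearly_independent2 v w" if "a *\<^sub>R v + b *\<^sub>R w = 0" "b \<noteq> 0" for a b v w
    proof -
      have "a * fst v + b * fst w = 0" "a * snd v + b * snd w = 0"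
        using that(1) by (auto simp: prod_eq_iff)
      then have "b * (fst v * snd w - snd v * fst w) = 0" by algebra
      then show ?thesis using that(2) by (simp add: linearly_independent2_def)
    qed
    ultimately show ?thesis using False unfolding D_def by blast
  qed
  moreover have "finite (double_points (bumped c))"
  proof (rule finite_subset)
    show "double_points (bumped c) \<subseteq> double_points \<gamma> \<union> (\<lambda>x. \<Psi> (0, x)) ` {x. c x = x}"
    proof
      fix q assume "q \<in> double_points (bumped c)"
      then obtain s t where st: "same_image (bumped c) s t" "q = bumped c s"
        by (auto simp: double_points_def)
      from st(1)[unfolded same_image_bumped]
      show "q \<in> double_points \<gamma> \<union> (\<lambda>x. \<Psi> (0, x)) ` {x. c x = x}"
      proof (elim disjE conjE exE)
        assume "same_image \<gamma> s t" "\<gamma> s \<noteq> \<gamma> s\<^sub>0"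
        then show ?thesis
          using bumped_far[OF far_if_double_point] st(2) by (auto simp: double_points_def)
      next
        fix x assume x: "c x = x" "s - (s\<^sub>0 + x) \<in> \<int>"
        then obtain n where "s - (s\<^sub>0 + x) = of_int n" by (auto elim: Ints_cases)
        then have "s = s\<^sub>0 + x + of_int n" by simp
        then have "q = \<Psi> (0, x)" using bumped_I[of x n] bump_range[of x] x st(2) by simp
        then show ?thesis using x by simp
      next
        fix x assume x: "c x = x" "s - (t\<^sub>0 + x) \<in> \<int>"
        then obtain n where "s - (t\<^sub>0 + x) = of_int n" by (auto elim: Ints_cases)
        then have "s = t\<^sub>0 + x + of_int n" by simp
        then have "q = \<Psi> (0, x)" using bumped_J[of x n] bump_range[of x] x st(2) by simp
        then show ?thesis using x by simp
      qed
    qed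
  qed (use generic finite_fixpoints in \<open>simp add: generic_immersion_def\<close>)
  moreover have "r - s \<in> \<int> \<or> s - t \<in> \<int> \<or> r - t \<in> \<int>"
    if rst: "bumped c r = bumped c s \<and> bumped c s = bumped c t" for r s t
  proof (cases "\<exists>x y. \<bar>x\<bar> \<le> 10 * \<epsilon> \<and> \<bar>y\<bar> \<le> 10 * \<epsilon> \<and> bumped c r = \<Psi> (x, y)")
    case True
    then obtain x y where xy: "\<bar>x\<bar> \<le> 10 * \<epsilon>" "\<bar>y\<bar> \<le> 10 * \<epsilon>" "bumped c r = \<Psi> (x, y)" by blast
    \<comment> \<open>A box point has at most two parameters modulo 1, so among three of them two
      are congruent.\<close>
    have "u - (s\<^sub>0 + (x + y)) \<in> \<int> \<or> u - (t\<^sub>0 + y) \<in> \<int>" if u: "bumped c u = \<Psi> (x, y)" for u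
    proof -
      from bumped_eq_chart_iff[OF xy(1,2), THEN iffD1, OF u]
      show ?thesis by (elim disjE exE conjE) simp_all
    qed
    from this[of r] this[of s] this[of t]
    have "r - (s\<^sub>0 + (x + y)) \<in> \<int> \<or> r - (t\<^sub>0 + y) \<in> \<int>"
      "s - (s\<^sub>0 + (x + y)) \<in> \<int> \<or> s - (t\<^sub>0 + y) \<in> \<int>"
      "t - (s\<^sub>0 + (x + y)) \<in> \<int> \<or> t - (t\<^sub>0 + y) \<in> \<int>"
      using rst xy(3) by simp_all
    moreover have "u - v \<in> \<int>" if "u - a \<in> \<int>" "v - a \<in> \<int>" for u v a :: real
      using Ints_diff[OF that] by simp
    ultimately show ?thesis by blast
  next
    case False
    have "bumped c u = \<gamma> u" if "bumped c u = bumped c r" for u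
      using False that by (cases u rule: bumped_cases) auto
    then have "\<gamma> r = \<gamma> s \<and> \<gamma> s = \<gamma> t" using rst by metis
    then show ?thesis using generic unfolding generic_immersion_def by blast
  qed
  moreover have "linearly_independent2 (D s) (D t)" if "same_image (bumped c) s t" for s t
  proof -
    have D_far: "D u = g' u" if "\<And>n::int. 4 * \<epsilon> \<le> \<bar>u - s\<^sub>0 - of_int n\<bar>" for u
      using extension_far[OF that] by (simp add: D_def e_def e'_def)
    have near: "linearly_independent2 (D s) (D t)" "linearly_independent2 (D t) (D s)"
      if x: "c x = x" "s - (s\<^sub>0 + x) \<in> \<int>" "t - (t\<^sub>0 + x) \<in> \<int>" for s t x
    proof -
      have xd: "\<bar>x\<bar> < \<delta>" using bump_range[of x] x by simp
      obtain m where m: "s - (s\<^sub>0 + x) = of_int m" using x(2) by (auto elim: Ints_cases)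
      obtain n where n: "t - (t\<^sub>0 + x) = of_int n" using x(3) by (auto elim: Ints_cases)
      have s: "s - s\<^sub>0 = x + of_int m" and t: "t = t\<^sub>0 + x + of_int n" using m n by auto
      have "e s = x" "e' s = c' x"
        using xd delta_small x(1) by (simp_all add: e_def e'_def s periodic_extension_shift)
      moreover have "g' (s - x) = g' s\<^sub>0" using m by (intro g'_congruent) (simp add: algebra_simps)
      ultimately have Ds: "D s = (1 - c' x) *\<^sub>R g' s\<^sub>0 + c' x *\<^sub>R g' (t\<^sub>0 + x)" by (simp add: D_def)
      have "D t = g' t" unfolding t by (rule D_far[OF J_far[OF xd]])
      then have Dt: "D t = g' (t\<^sub>0 + x)" using g'_congruent[OF x(3)] by simp
      have "linearly_independent2 (g' s\<^sub>0) (g' (t\<^sub>0 + x))"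
        using independent[of 0 x] xd by (simp add: g'_def)
      moreover have "1 - c' x \<noteq> 0" using fixpoint_deriv[OF x(1)] by simp
      \<comment> \<open>Adding a multiple of \<open>w\<close> to \<open>a *\<^sub>R v\<close> does
        not change the determinant with \<open>w\<close>; this is applied with
        \<open>a = 1 - c' x\<close>.\<close>
      moreover have "linearly_independent2 (a *\<^sub>R v + b *\<^sub>R w) w \<and> linearly_independent2 w (a *\<^sub>R v + b *\<^sub>R w)"
        if "linearly_independent2 v w" "a \<noteq> 0" for a b v w
      proof -
        have "(a * fst v + b * fst w) * snd w - (a * snd v + b * snd w) * fst w
          = a * (fst v * snd w - snd v * fst w)" by algebra
        moreover have "a * (fst v * snd w - snd v * fst w) \<noteq> 0"
          using that by (simp add: linearly_independent2_def)
        ultimately show ?thesis by (simp add: linearly_independent2_def algebra_simps)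
      qed
      ultimately show "linearly_independent2 (D s) (D t)" "linearly_independent2 (D t) (D s)"
        unfolding Ds Dt by blast+
    qed
    from that[unfolded same_image_bumped] show ?thesis
    proof (elim disjE conjE exE)
      assume f: "same_image \<gamma> s t" "\<gamma> s \<noteq> \<gamma> s\<^sub>0"
      have "same_image \<gamma> t s" "\<gamma> t \<noteq> \<gamma> s\<^sub>0"
        using f by (blast intro: same_image_sym, auto simp: same_image_def)
      then have "D t = g' t" by (intro D_far far_if_double_point)
      moreover have "D s = g' s" using f by (intro D_far far_if_double_point)
      moreover have "linearly_independent2 (g' s) (g' t)"
        using generic f(1) by (simp add: generic_immersion_def g'_def)
      ultimately show ?thesis by simp
    qed (use near in blast)+
  qed
  moreover have "bumped c (t + 1) = bumped c t" for t
  proof -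
    have "periodic_extension c (t + 1 - s\<^sub>0) = periodic_extension c (t - s\<^sub>0)"
      using periodic_extension_periodic[of c "t - s\<^sub>0"] by (simp add: algebra_simps)
    then have "e (t + 1) = e t" by (simp add: e_def)
    then show ?thesis using periodic[of "t - e t" 1] by (simp add: bumped algebra_simps)
  qed
  ultimately show ?thesis unfolding generic_immersion_def vd by blast
qed

end

section \<open>Second Reidemeister moves near a crossing\<close>

context crossing_chart
begin

text \<open>These are the conditions that a virtual diagram puts on its over-set, restricted to the
  crossings other than the charted one. They do not mention \<open>c\<close>, so one set serves all
  deformations of the curve.\<close>

definition residual_over :: "real set \<Rightarrow> bool" where
  "residual_over R \<longleftrightarrow> (\<forall>t. t + 1 \<in> R \<longleftrightarrow> t \<in> R) \<and>
     (\<forall>t\<in>R. \<gamma> t \<noteq> \<gamma> s\<^sub>0 \<and> (\<exists>s. same_image \<gamma> s t)) \<and>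
     (\<forall>s t. same_image \<gamma> s t \<and> s \<in> R \<longrightarrow> t \<notin> R)"

text \<open>\<open>R\<close> marks the crossings away from the chart, \<open>A\<close> and \<open>B\<close> those fixed points of \<open>c\<close> at which the
  first or the second strand is over.\<close>

definition marked :: "(real \<Rightarrow> real) \<Rightarrow> real set \<Rightarrow> real set \<Rightarrow> real set \<Rightarrow> vdiagram" where
  "marked c R A B = \<lparr>curve = bumped c,
     over = R \<union> {t. \<exists>x\<in>A. t - (s\<^sub>0 + x) \<in> \<int>} \<union> {t. \<exists>x\<in>B. t - (t\<^sub>0 + x) \<in> \<int>}\<rparr>"

lemma curve_marked [simp]: "curve (marked c R A B) = bumped c"
  by (simp add: marked_def)

lemma congruent_eq:
  fixes x y :: real
  assumes "t - (a + x) \<in> \<int>" "t - (a + y) \<in> \<int>" "\<bar>x\<bar> < \<delta>" "\<bar>y\<bar> < \<delta>"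
  shows "x = y"
proof -
  have "t - (a + x) - (t - (a + y)) \<in> \<int>" using Ints_diff assms(1,2) by blast
  then have "y - x \<in> \<int>" by simp
  then obtain n :: int where "y - x = of_int n" by (auto elim: Ints_cases)
  moreover have "\<bar>y - x\<bar> < 1" using assms delta_small by linarith
  ultimately have "\<bar>n\<bar> < 1" by linarith
  with \<open>y - x = of_int n\<close> show ?thesis by simp
qed

lemma not_both_strands:
  assumes "t - (s\<^sub>0 + x) \<in> \<int>" "t - (t\<^sub>0 + y) \<in> \<int>" "\<bar>x\<bar> < \<delta>" "\<bar>y\<bar> < \<delta>"
  shows False
proof -
  have "t - (t\<^sub>0 + y) - (t - (s\<^sub>0 + x)) \<in> \<int>" using Ints_diff assms(1,2) by blast
  then show False using strands_disjoint[OF assms(3,4)] by (simp add: algebra_simps)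
qed

lemma double_point_outside:
  assumes "same_image \<gamma> t u" "\<gamma> t \<noteq> \<gamma> s\<^sub>0" "\<bar>x\<bar> \<le> 10 * \<epsilon>"
  shows "t - (s\<^sub>0 + x) \<notin> \<int>" "t - (t\<^sub>0 + x) \<notin> \<int>"
proof -
  have False if "\<gamma> t = \<Psi> (x, 0) \<or> \<gamma> t = \<Psi> (0, x)"
  proof -
    have "x = 0"
      using that chart_double_point[of x 0 t u] chart_double_point[of 0 x t u] assms eps_pos by auto
    then show False using that assms(2) by (auto simp: chart_axes crossing_eq)
  qed
  then show "t - (s\<^sub>0 + x) \<notin> \<int>" "t - (t\<^sub>0 + x) \<notin> \<int>"
    using congruent by (auto simp: chart_axes)
qed

lemma residual_outside:
  assumes "residual_over R" "t \<in> R" "\<bar>x\<bar> \<le> 10 * \<epsilon>"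
  shows "t - (s\<^sub>0 + x) \<notin> \<int>" "t - (t\<^sub>0 + x) \<notin> \<int>"
proof -
  obtain s where "same_image \<gamma> s t" "\<gamma> t \<noteq> \<gamma> s\<^sub>0"
    using assms unfolding residual_over_def by blast
  from double_point_outside[OF same_image_sym[OF this(1)] this(2) assms(3)]
  show "t - (s\<^sub>0 + x) \<notin> \<int>" "t - (t\<^sub>0 + x) \<notin> \<int>" .
qed

text \<open>The three parts of the over-set do not interfere in the box: \<open>R\<close> has no
  parameter there, and parameters on the two strands are neither congruent to each other nor
  ambiguous within one strand.\<close>

lemma over_marked:
  assumes R: "residual_over R" and AB: "\<And>y. y \<in> A \<union> B \<Longrightarrow> \<bar>y\<bar> < 4 * \<epsilon>" and x: "\<bar>x\<bar> \<le> 10 * \<epsilon>"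
  shows "t - (s\<^sub>0 + x) \<in> \<int> \<Longrightarrow> t \<in> over (marked c R A B) \<longleftrightarrow> x \<in> A"
    and "t - (t\<^sub>0 + x) \<in> \<int> \<Longrightarrow> t \<in> over (marked c R A B) \<longleftrightarrow> x \<in> B"
proof -
  have x': "\<bar>x\<bar> \<le> 10 * \<epsilon>" "\<bar>x\<bar> < \<delta>" using x eps_pos eps_delta by linarith+
  have y': "\<bar>y\<bar> < \<delta>" if "y \<in> A \<union> B" for y using AB[OF that] eps_pos eps_delta by linarith
  show "t \<in> over (marked c R A B) \<longleftrightarrow> x \<in> A" if t: "t - (s\<^sub>0 + x) \<in> \<int>"
  proof -
    have "t \<notin> R" using residual_outside[OF R _ x'(1)] t by blast
    moreover have "y = x" if "y \<in> A" "t - (s\<^sub>0 + y) \<in> \<int>" for y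
      using congruent_eq[OF that(2) t] y' that x' by blast
    moreover have "t - (t\<^sub>0 + y) \<notin> \<int>" if "y \<in> B" for y
      using not_both_strands[OF t _ x'(2), of y] y' that by blast
    ultimately show ?thesis using t by (auto simp: marked_def)
  qed
  show "t \<in> over (marked c R A B) \<longleftrightarrow> x \<in> B" if t: "t - (t\<^sub>0 + x) \<in> \<int>"
  proof -
    have "t \<notin> R" using residual_outside[OF R _ x'(1)] t by blast
    moreover have "y = x" if "y \<in> B" "t - (t\<^sub>0 + y) \<in> \<int>" for y
      using congruent_eq[OF that(2) t] y' that x' by blast
    moreover have "t - (s\<^sub>0 + y) \<notin> \<int>" if "y \<in> A" for y
      using not_both_strands[OF _ t _ x'(2), of y] y' that by blast
    ultimately show ?thesis using t by (auto simp: marked_def)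
  qed
qed

text \<open>The coordinate sum at parameter \<open>x\<close> is \<open>x\<close> on the deformed
  strand, at \<open>(x - c x, c x)\<close>, as well as on the axis, at \<open>(0, x)\<close>. A
  strip between two levels of the sum therefore cuts both strands exactly in the parameter interval
  from \<open>a\<close> to \<open>b\<close>, for every \<open>c\<close>. The sides are never
  touched: \<open>\<bar>x - 2 * c x\<bar>\<close> is less than
  \<open>4 * \<epsilon> + 12 * \<epsilon>\<close>.\<close>

definition band :: "real \<Rightarrow> real \<Rightarrow> (real \<times> real) set" where
  "band a b = {(x, y). a \<le> x + y \<and> x + y \<le> b \<and> \<bar>x - y\<bar> \<le> 16 * \<epsilon>}"

lemma band_halfspaces:
  "band a b = {q. (-1, -1) \<bullet> q \<le> - a} \<inter> {q. (1, 1) \<bullet> q \<le> b} \<inter>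
     {q. (1, -1) \<bullet> q \<le> 16 * \<epsilon>} \<inter> {q. (-1, 1) \<bullet> q \<le> 16 * \<epsilon>}"
  by (auto simp: band_def)

lemma interior_band:
  "interior (band a b) = {(x, y). a < x + y \<and> x + y < b \<and> \<bar>x - y\<bar> < 16 * \<epsilon>}"
proof -
  have nz: "(-1, -1) \<noteq> (0 :: real \<times> real)" "(1, 1) \<noteq> (0 :: real \<times> real)"
    "(1, -1) \<noteq> (0 :: real \<times> real)" "(-1, 1) \<noteq> (0 :: real \<times> real)"
    by (auto simp: zero_prod_def)
  show ?thesis
    unfolding band_halfspaces interior_Int
      interior_halfspace_le[OF nz(1)] interior_halfspace_le[OF nz(2)]
      interior_halfspace_le[OF nz(3)] interior_halfspace_le[OF nz(4)]
    by auto
qed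

text \<open>Each coordinate is half the sum or difference of \<open>x + y\<close> and
  \<open>x - y\<close>, hence at most half of
  \<open>4 * \<epsilon> + 16 * \<epsilon>\<close>.\<close>

lemma band_small:
  assumes "(x, y) \<in> band a b" "- (4 * \<epsilon>) < a" "b < 4 * \<epsilon>"
  shows "\<bar>x\<bar> \<le> 10 * \<epsilon>" "\<bar>y\<bar> \<le> 10 * \<epsilon>"
  using assms by (auto simp: band_def)

lemma band_in_chart:
  assumes "- (4 * \<epsilon>) < a" "b < 4 * \<epsilon>"
  shows "band a b \<subseteq> {-\<delta><..<\<delta>} \<times> {-\<delta><..<\<delta>}"
proof clarify
  fix x y assume "(x, y) \<in> band a b"
  from band_small[OF this assms] show "x \<in> {-\<delta><..<\<delta>} \<and> y \<in> {-\<delta><..<\<delta>}" using eps_delta by auto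
qed

lemma chart_continuous: "continuous_on S \<Psi>"
  unfolding \<Psi>_def case_prod_unfold
  by (intro continuous_intros continuous_on_compose2[OF generic_immersion_continuous[OF generic, of UNIV]]) auto

lemma chart_inj': "inj_on \<Psi> ({-\<delta><..<\<delta>} \<times> {-\<delta><..<\<delta>})"
  using chart_inj by (simp add: \<Psi>_def)

lemma compact_band:
  assumes "- (4 * \<epsilon>) < a" "b < 4 * \<epsilon>"
  shows "compact (band a b)"
proof -
  have "bounded (band a b)"
  proof (rule bounded_subset)
    show "band a b \<subseteq> {-\<delta>..\<delta>} \<times> {-\<delta>..\<delta>}" using band_in_chart[OF assms] by force
  qed (intro bounded_Times bounded_closed_interval)
  moreover have "closed (band a b)"
    unfolding band_halfspaces by (intro closed_Int closed_halfspace_le)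
  ultimately show ?thesis by (simp add: compact_eq_bounded_closed)
qed

text \<open>The band is compact and convex with nonempty interior, hence a disc, and the chart is
  injective and continuous on it.\<close>

lemma chart_band_disc:
  assumes "- (4 * \<epsilon>) < a" "a < b" "b < 4 * \<epsilon>"
  shows "\<Psi> ` band a b homeomorphic cball (0 :: plane) 1"
proof -
  have "((a + b) / 4, (a + b) / 4) \<in> interior (band a b)"
    using assms eps_pos by (auto simp: interior_band)
  moreover have "convex (band a b)"
    unfolding band_halfspaces by (intro convex_Int convex_halfspace_le)
  ultimately have "band a b homeomorphic cball (0 :: plane) 1"
    using compact_band[OF assms(1,3)]
    by (intro homeomorphic_convex_compact_cball) auto
  moreover have "band a b homeomorphic \<Psi> ` band a b"
    by (rule homeomorphic_compact[OF compact_band chart_continuous refl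
        inj_on_subset[OF chart_inj' band_in_chart]]) (use assms in auto)
  ultimately show ?thesis by (meson homeomorphic_sym homeomorphic_trans)
qed

text \<open>Invariance of domain makes the chart open, so the interior demanded by
  \<open>meets_in_strands\<close> can be computed in coordinates.\<close>

lemma interior_chart_band:
  assumes "- (4 * \<epsilon>) < a" "b < 4 * \<epsilon>"
  shows "interior (\<Psi> ` band a b) = \<Psi> ` interior (band a b)"
  by (rule interior_injective_image[OF chart_continuous _ chart_inj' band_in_chart[OF assms]])
     (simp add: open_Times)

lemma disjoint_strands:
  assumes "- (4 * \<epsilon>) < a" "b < 4 * \<epsilon>"
  shows "disjnt (closed_strand (t\<^sub>0 + a, t\<^sub>0 + b)) (closed_strand (s\<^sub>0 + a, s\<^sub>0 + b))"
proof -
  have False if t: "t\<^sub>0 + a + of_int m \<le> t" "t \<le> t\<^sub>0 + b + of_int m"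
    "s\<^sub>0 + a + of_int n \<le> t" "t \<le> s\<^sub>0 + b + of_int n" for t m n
  proof -
    have "t - (s\<^sub>0 + (t - s\<^sub>0 - of_int n)) \<in> \<int>" "t - (t\<^sub>0 + (t - t\<^sub>0 - of_int m)) \<in> \<int>" by simp_all
    then show False by (rule not_both_strands) (use t assms eps_delta eps_pos in auto)
  qed
  then show ?thesis by (auto simp: disjnt_iff closed_strand_def)
qed

end

lemma mem_open_strand: "t \<in> open_strand (d + a, d + b) \<longleftrightarrow> (\<exists>x n. t = d + x + of_int n \<and> a < x \<and> x < b)"
proof
  assume "t \<in> open_strand (d + a, d + b)"
  then obtain n :: int where "d + a + of_int n < t" "t < d + b + of_int n" by (auto simp: open_strand_def)
  then show "\<exists>x n. t = d + x + of_int n \<and> a < x \<and> x < b"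
    by (intro exI[of _ "t - d - of_int n"] exI[of _ n]) auto
next
  assume "\<exists>x n. t = d + x + of_int n \<and> a < x \<and> x < b"
  then obtain x and n :: int where "t = d + x + of_int n" "a < x" "x < b" by blast
  then have "t \<in> {d + a + of_int n <..< d + b + of_int n}" by simp
  then show "t \<in> open_strand (d + a, d + b)" unfolding open_strand_def by auto
qed

lemma mem_closed_strand: "t \<in> closed_strand (d + a, d + b) \<longleftrightarrow> (\<exists>x n. t = d + x + of_int n \<and> a \<le> x \<and> x \<le> b)"
proof
  assume "t \<in> closed_strand (d + a, d + b)"
  then obtain n :: int where "d + a + of_int n \<le> t" "t \<le> d + b + of_int n" by (auto simp: closed_strand_def)
  then show "\<exists>x n. t = d + x + of_int n \<and> a \<le> x \<and> x \<le> b"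
    by (intro exI[of _ "t - d - of_int n"] exI[of _ n]) auto
next
  assume "\<exists>x n. t = d + x + of_int n \<and> a \<le> x \<and> x \<le> b"
  then obtain x and n :: int where "t = d + x + of_int n" "a \<le> x" "x \<le> b" by blast
  then have "t \<in> {d + a + of_int n .. d + b + of_int n}" by simp
  then show "t \<in> closed_strand (d + a, d + b)" unfolding closed_strand_def by auto
qed

section \<open>Marked diagrams and how bands meet them\<close>

context chart_bump
begin

lemma fixpoint_box: "c x = x \<Longrightarrow> \<bar>x\<bar> \<le> 10 * \<epsilon>"
  using fixpoint_small[of x] eps_pos by linarith

lemma virtual_diagram_marked:
  assumes R: "residual_over R" and A: "A \<subseteq> {x. c x = x}" and B: "B \<subseteq> {x. c x = x}" and AB: "A \<inter> B = {}"
  shows "virtual_diagram (marked c R A B)"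
proof -
  have small: "\<And>y. y \<in> A \<union> B \<Longrightarrow> \<bar>y\<bar> < 4 * \<epsilon>" using A B fixpoint_small by blast
  have om: "t \<in> over (marked c R A B) \<longleftrightarrow> x \<in> A" if "c x = x" "t - (s\<^sub>0 + x) \<in> \<int>" for t x
    by (rule over_marked(1)[OF R small fixpoint_box[OF that(1)] that(2)])
  have om': "t \<in> over (marked c R A B) \<longleftrightarrow> x \<in> B" if "c x = x" "t - (t\<^sub>0 + x) \<in> \<int>" for t x
    by (rule over_marked(2)[OF R small fixpoint_box[OF that(1)] that(2)])
  have partner_R: "\<exists>s. same_image (bumped c) s t" if t: "t \<in> R" for t
  proof -
    obtain s where "same_image \<gamma> s t" "\<gamma> t \<noteq> \<gamma> s\<^sub>0" 
      using R[unfolded residual_over_def, THEN conjunct2, THEN conjunct1] t by blast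
    then have "same_image \<gamma> s t \<and> \<gamma> s \<noteq> \<gamma> s\<^sub>0" by (simp add: same_image_def)
    then show ?thesis unfolding same_image_bumped by blast
  qed
  have partner: "\<exists>s. same_image (bumped c) s t"
    if "c x = x" "t - (s\<^sub>0 + x) \<in> \<int> \<or> t - (t\<^sub>0 + x) \<in> \<int>" for t x
  proof -
    from that(2) show ?thesis
    proof
      assume "t - (s\<^sub>0 + x) \<in> \<int>"
      then have "same_image (bumped c) (t\<^sub>0 + x) t"
        unfolding same_image_bumped using that(1) by (intro disjI2 exI[of _ x]) simp
      then show ?thesis by blast
    next
      assume "t - (t\<^sub>0 + x) \<in> \<int>"
      then have "same_image (bumped c) (s\<^sub>0 + x) t"
        unfolding same_image_bumped using that(1) by (intro disjI2 exI[of _ x]) simp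
      then show ?thesis by blast
    qed
  qed
  have shift: "t + 1 - a \<in> \<int> \<longleftrightarrow> t - a \<in> \<int>" for t a :: real
    using Ints_diff[of "t + 1 - a" 1] Ints_add[of "t - a" 1] by (auto simp: algebra_simps)
  have "t + 1 \<in> over (marked c R A B) \<longleftrightarrow> t \<in> over (marked c R A B)" for t
    using R unfolding residual_over_def marked_def by (simp only: vdiagram.simps Un_iff mem_Collect_eq shift)
  moreover have "\<exists>s. same_image (bumped c) s t" if "t \<in> over (marked c R A B)" for t
    using that A B partner partner_R unfolding marked_def by auto
  moreover have "t \<notin> over (marked c R A B)"
    if st: "same_image (bumped c) s t" and s: "s \<in> over (marked c R A B)" for s t
    using st[unfolded same_image_bumped]
  proof (elim disjE conjE exE)
    assume f: "same_image \<gamma> s t" "\<gamma> s \<noteq> \<gamma> s\<^sub>0"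
    then have f': "same_image \<gamma> t s" "\<gamma> t \<noteq> \<gamma> s\<^sub>0"
      by (blast intro: same_image_sym, auto simp: same_image_def)
    have y: "\<bar>y\<bar> \<le> 10 * \<epsilon>" if "y \<in> A \<union> B" for y using small[OF that] eps_pos by linarith
    have "s \<in> R" using s double_point_outside[OF f y] by (auto simp: marked_def)
    then have "t \<notin> R" using f R unfolding residual_over_def by blast
    then show ?thesis using double_point_outside[OF f' y] by (auto simp: marked_def)
  next
    fix x assume x: "c x = x" "s - (s\<^sub>0 + x) \<in> \<int>" "t - (t\<^sub>0 + x) \<in> \<int>"
    show ?thesis using om[OF x(1,2)] om'[OF x(1,3)] s AB by blast
  next
    fix x assume x: "c x = x" "t - (s\<^sub>0 + x) \<in> \<int>" "s - (t\<^sub>0 + x) \<in> \<int>"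
    show ?thesis using om[OF x(1,2)] om'[OF x(1,3)] s AB by blast
  qed
  ultimately show ?thesis
    using generic_immersion_bumped unfolding virtual_diagram_def curve_marked by blast
qed

text \<open>Stated for an arbitrary subset of the band so as to apply both to the band and to its
  interior.\<close>

lemma bumped_preimage:
  assumes S: "S \<subseteq> band a b" and ab: "- (4 * \<epsilon>) < a" "b < 4 * \<epsilon>"
  shows "bumped c t \<in> \<Psi> ` S \<longleftrightarrow>
    (\<exists>x n. t = s\<^sub>0 + x + of_int n \<and> (x - c x, c x) \<in> S) \<or> (\<exists>y n. t = t\<^sub>0 + y + of_int n \<and> (0, y) \<in> S)"
    (is "_ \<longleftrightarrow> ?R")
proof
  assume "bumped c t \<in> \<Psi> ` S"
  then obtain x y where xy: "(x, y) \<in> S" "bumped c t = \<Psi> (x, y)" by auto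
  have "\<bar>x\<bar> \<le> 10 * \<epsilon>" "\<bar>y\<bar> \<le> 10 * \<epsilon>" using band_small[OF _ ab] xy S by blast+
  from bumped_eq_chart_iff[OF this, THEN iffD1, OF xy(2)] xy(1) show ?R by blast
next
  assume ?R
  then show "bumped c t \<in> \<Psi> ` S"
  proof (elim disjE exE conjE)
    fix x n assume x: "t = s\<^sub>0 + x + real_of_int n" "(x - c x, c x) \<in> S"
    then have "(x - c x, c x) \<in> band a b" using S by blast
    then have "\<bar>x\<bar> < \<delta>" using ab eps_pos eps_delta by (auto simp: band_def)
    then show ?thesis using bumped_I[of x n] x by auto
  next
    fix y n assume y: "t = t\<^sub>0 + y + real_of_int n" "(0, y) \<in> S"
    then have "(0, y) \<in> band a b" using S by blast
    then have "\<bar>y\<bar> < \<delta>" using ab eps_pos eps_delta by (auto simp: band_def)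
    then show ?thesis using bumped_J[of y n] y by auto
  qed
qed

text \<open>Disc and strands do not depend on \<open>c\<close>, so the diagrams before and after a
  move can share them. The second strand comes first in the list because it is the over-strand of
  the classical bigons.\<close>

lemma meets_band:
  assumes ab: "- (4 * \<epsilon>) < a" "b < 4 * \<epsilon>" and D: "curve D = bumped c"
  shows "meets_in_strands D (\<Psi> ` band a b) [(t\<^sub>0 + a, t\<^sub>0 + b), (s\<^sub>0 + a, s\<^sub>0 + b)]"
proof -
  have I: "\<bar>x - c x - c x\<bar> < 16 * \<epsilon>" "\<bar>x\<bar> < 16 * \<epsilon>" if "a \<le> x" "x \<le> b" for x
    using bump_bound[of x] that ab by linarith+
  have closed: "(x - c x, c x) \<in> band a b \<longleftrightarrow> a \<le> x \<and> x \<le> b"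
    "(0, x) \<in> band a b \<longleftrightarrow> a \<le> x \<and> x \<le> b" for x
    using I[of x] by (auto simp: band_def)
  have "open": "(x - c x, c x) \<in> interior (band a b) \<longleftrightarrow> a < x \<and> x < b"
    "(0, x) \<in> interior (band a b) \<longleftrightarrow> a < x \<and> x < b" for x
    using I[of x] by (auto simp: interior_band)
  have "bumped c t \<in> \<Psi> ` band a b \<longleftrightarrow>
      t \<in> closed_strand (t\<^sub>0 + a, t\<^sub>0 + b) \<union> closed_strand (s\<^sub>0 + a, s\<^sub>0 + b)" for t
    unfolding bumped_preimage[OF subset_refl ab] Un_iff mem_closed_strand
    closed by blast
  moreover have "bumped c t \<in> interior (\<Psi> ` band a b) \<longleftrightarrow>
      t \<in> open_strand (t\<^sub>0 + a, t\<^sub>0 + b) \<union> open_strand (s\<^sub>0 + a, s\<^sub>0 + b)" for t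
    unfolding interior_chart_band[OF ab] bumped_preimage[OF interior_subset ab] Un_iff mem_open_strand
    "open" by blast
  ultimately show ?thesis by (simp add: meets_in_strands_def D set_eq_iff)
qed

text \<open>A band lies in the free box, so no unchanged double point enters it; a new one enters
  exactly when its level \<open>x\<close> does.\<close>

lemma double_points_band:
  assumes ab: "- (4 * \<epsilon>) < a" "b < 4 * \<epsilon>"
  shows "double_points (bumped c) \<inter> \<Psi> ` band a b = (\<lambda>x. \<Psi> (0, x)) ` {x. c x = x \<and> a \<le> x \<and> x \<le> b}"
proof (intro set_eqI iffI)
  fix q assume q: "q \<in> double_points (bumped c) \<inter> \<Psi> ` band a b"
  then obtain s t where st: "same_image (bumped c) s t" "bumped c s = q" by (auto simp: double_points_def)
  have near: "q \<in> (\<lambda>x. \<Psi> (0, x)) ` {x. c x = x \<and> a \<le> x \<and> x \<le> b}"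
    if x: "c x = x" "q = \<Psi> (0, x)" for x
  proof -
    have "\<bar>x\<bar> < \<delta>" using bump_range[of x] x(1) by simp
    moreover obtain x' y' where xy: "(x', y') \<in> band a b" "q = \<Psi> (x', y')" using q by auto
    moreover have "\<bar>x'\<bar> < \<delta>" "\<bar>y'\<bar> < \<delta>" using band_small[OF xy(1) ab] eps_delta by linarith+
    ultimately have "0 = x' \<and> x = y'"
      using chart_eqD[of 0 x x' y'] x(2) eps_delta eps_pos by simp
    then have "(0, x) \<in> band a b" using xy by simp
    then show ?thesis using x by (auto simp: band_def)
  qed
  from q st have "bumped c s \<in> \<Psi> ` band a b" by simp
  then have s: "\<exists>x. \<bar>x\<bar> \<le> 10 * \<epsilon> \<and> (s - (s\<^sub>0 + x) \<in> \<int> \<or> s - (t\<^sub>0 + x) \<in> \<int>)"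
    unfolding bumped_preimage[OF subset_refl ab]
  proof (elim disjE exE conjE)
    fix x n assume x: "s = s\<^sub>0 + x + real_of_int n" "(x - c x, c x) \<in> band a b"
    then have "\<bar>x\<bar> \<le> 10 * \<epsilon>" using ab eps_pos by (auto simp: band_def)
    then show ?thesis using x by (intro exI[of _ x]) simp
  next
    fix y n assume y: "s = t\<^sub>0 + y + real_of_int n" "(0, y) \<in> band a b"
    then have "\<bar>y\<bar> \<le> 10 * \<epsilon>" using ab eps_pos by (auto simp: band_def)
    then show ?thesis using y by (intro exI[of _ y]) simp
  qed
  from st(1)[unfolded same_image_bumped]
  show "q \<in> (\<lambda>x. \<Psi> (0, x)) ` {x. c x = x \<and> a \<le> x \<and> x \<le> b}"
  proof (elim disjE conjE exE)
    assume "same_image \<gamma> s t" "\<gamma> s \<noteq> \<gamma> s\<^sub>0"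
    from double_point_outside[OF this] s show ?thesis by blast
  next
    fix x assume x: "c x = x" "s - (s\<^sub>0 + x) \<in> \<int>"
    then obtain n where "s - (s\<^sub>0 + x) = of_int n" by (auto elim: Ints_cases)
    then have "s = s\<^sub>0 + x + of_int n" by simp
    then have "q = \<Psi> (0, x)" using bumped_I[of x n] bump_range[of x] x st(2) by simp
    then show ?thesis using near x by blast
  next
    fix x assume x: "c x = x" "s - (t\<^sub>0 + x) \<in> \<int>"
    then obtain n where "s - (t\<^sub>0 + x) = of_int n" by (auto elim: Ints_cases)
    then have "s = t\<^sub>0 + x + of_int n" by simp
    then have "q = \<Psi> (0, x)" using bumped_J[of x n] bump_range[of x] x st(2) by simp
    then show ?thesis using near x by blast
  qed
next
  fix q assume "q \<in> (\<lambda>x. \<Psi> (0, x)) ` {x. c x = x \<and> a \<le> x \<and> x \<le> b}"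
  then obtain x where x: "q = \<Psi> (0, x)" "c x = x" "a \<le> x" "x \<le> b" by auto
  have "same_image (bumped c) (s\<^sub>0 + x) (t\<^sub>0 + x)"
    unfolding same_image_bumped using x(2) by auto
  moreover have "bumped c (s\<^sub>0 + x) = q"
    using bumped_I[of x 0] bump_range[of x] x(1,2) by simp
  moreover have "(0, x) \<in> band a b" using x bump_bound[of x] by (simp add: band_def)
  ultimately show "q \<in> double_points (bumped c) \<inter> \<Psi> ` band a b"
    using x(1) by (auto simp: double_points_def)
qed

end

section \<open>Bigon moves between two bumps that agree outside an interval\<close>

context crossing_chart
begin

lemma bumped_agree:
  assumes "\<And>x. x \<notin> {a<..<b} \<Longrightarrow> c x = e x" "t \<notin> open_strand (s\<^sub>0 + a, s\<^sub>0 + b)"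
  shows "bumped c t = bumped e t"
proof -
  define x where "x = frac (t - s\<^sub>0 + 1/2) - 1/2"
  have "t = s\<^sub>0 + x + of_int \<lfloor>t - s\<^sub>0 + 1/2\<rfloor>" by (simp add: x_def frac_def)
  then have "x \<notin> {a<..<b}" using assms(2) unfolding mem_open_strand by auto
  then have "periodic_extension c (t - s\<^sub>0) = periodic_extension e (t - s\<^sub>0)"
    using assms(1) by (simp add: periodic_extension_def x_def)
  then show ?thesis by (simp add: bumped_def)
qed

lemma open_strand_translate:
  assumes "t - (d + x) \<in> \<int>" "x \<in> {a<..<b}"
  shows "t \<in> open_strand (d + a, d + b)"
proof -
  obtain n where "t - (d + x) = of_int n" using assms(1) by (auto elim: Ints_cases)
  then have "t = d + x + of_int n" by simp
  then show ?thesis using assms(2) unfolding mem_open_strand by auto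
qed

lemma local_change_marked:
  assumes C: "chart_bump \<gamma> s\<^sub>0 t\<^sub>0 \<delta> \<epsilon> c c'" and E: "chart_bump \<gamma> s\<^sub>0 t\<^sub>0 \<delta> \<epsilon> e e'"
    and ab: "- (4 * \<epsilon>) < a" "a < b" "b < 4 * \<epsilon>"
    and agree: "\<And>x. x \<notin> {a<..<b} \<Longrightarrow> c x = e x"
    and A: "A - {a<..<b} = A' - {a<..<b}" and B: "B - {a<..<b} = B' - {a<..<b}"
  shows "local_change (\<Psi> ` band a b) [(t\<^sub>0 + a, t\<^sub>0 + b), (s\<^sub>0 + a, s\<^sub>0 + b)]
    (marked c R A B) (marked e R A' B')"
proof -
  have disj: "disjnt (closed_strand (t\<^sub>0 + a, t\<^sub>0 + b)) (closed_strand (s\<^sub>0 + a, s\<^sub>0 + b))"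
    by (rule disjoint_strands[OF ab(1,3)])
  have "t\<^sub>0 + a \<in> closed_strand (t\<^sub>0 + a, t\<^sub>0 + b)"
    unfolding mem_closed_strand using ab by (intro exI[of _ a] exI[of _ 0]) simp
  then have ne: "(t\<^sub>0 + a, t\<^sub>0 + b) \<noteq> (s\<^sub>0 + a, s\<^sub>0 + b)" using disj by (auto simp: disjnt_def)
  have over: "t \<in> over (marked c R A B) \<longleftrightarrow> t \<in> over (marked e R A' B')"
    if t: "t \<notin> open_strand (s\<^sub>0 + a, s\<^sub>0 + b)" "t \<notin> open_strand (t\<^sub>0 + a, t\<^sub>0 + b)" for t
  proof -
    have "x \<in> A \<longleftrightarrow> x \<in> A'" if "t - (s\<^sub>0 + x) \<in> \<int>" for x
      using open_strand_translate[OF that] t(1) A by blast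
    moreover have "x \<in> B \<longleftrightarrow> x \<in> B'" if "t - (t\<^sub>0 + x) \<in> \<int>" for x
      using open_strand_translate[OF that] t(2) B by blast
    ultimately show ?thesis unfolding marked_def by auto
  qed
  have curve: "bumped c t = bumped e t" if "t \<notin> open_strand (s\<^sub>0 + a, s\<^sub>0 + b)" for t
    using bumped_agree[of a b c e, OF agree that] .
  show ?thesis
    unfolding local_change_def
    using chart_band_disc[OF ab] ne disj ab eps_delta delta_small over curve
      chart_bump.meets_band[OF C ab(1,3) curve_marked]
      chart_bump.meets_band[OF E ab(1,3) curve_marked]
    by (auto simp: pairwise_insert disjnt_sym)
qed

text \<open>The geometry is the same for both moves: on the band, \<open>c\<close> has no fixed
  point and \<open>e\<close> has two. Only the marking of these two decides whether the bigon is
  classical, with the second strand over, or virtual.\<close>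

lemma bigon_marked:
  assumes C: "chart_bump \<gamma> s\<^sub>0 t\<^sub>0 \<delta> \<epsilon> c c'" and E: "chart_bump \<gamma> s\<^sub>0 t\<^sub>0 \<delta> \<epsilon> e e'"
    and ab: "- (4 * \<epsilon>) < a" "b < 4 * \<epsilon>"
    and agree: "\<And>x. x \<notin> {a<..<b} \<Longrightarrow> c x = e x"
    and none: "\<And>x. a \<le> x \<Longrightarrow> x \<le> b \<Longrightarrow> c x \<noteq> x"
    and two: "{x. e x = x \<and> a \<le> x \<and> x \<le> b} = {u, v}" and uv: "u < v"
    and R: "residual_over R" and A: "A \<subseteq> {x. e x = x}" and B: "B \<subseteq> {x. e x = x}"
  shows "u \<in> B \<Longrightarrow> v \<in> B \<Longrightarrow> R2 (marked c R A (B - {u, v})) (marked e R A B)"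
    and "u \<notin> A \<union> B \<Longrightarrow> v \<notin> A \<union> B \<Longrightarrow> vR2 (marked c R A B) (marked e R A B)"
proof -
  interpret E: chart_bump \<gamma> s\<^sub>0 t\<^sub>0 \<delta> \<epsilon> e e' by (rule E)
  have fix_uv: "e u = u" "e v = v" and uv_ab: "a \<le> u" "u \<le> b" "a \<le> v" "v \<le> b"
    using two by auto
  \<comment> \<open>The two functions agree at \<open>a\<close> and \<open>b\<close>, and
    \<open>c\<close> has no fixed point there, so \<open>u\<close> and \<open>v\<close> lie in the
    open interval.\<close>
  have "c a \<noteq> a" "c b \<noteq> b" using none uv_ab by force+
  then have "e a \<noteq> a" "e b \<noteq> b" using agree[of a] agree[of b] by auto
  then have uv_open: "u \<in> {a<..<b}" "v \<in> {a<..<b}"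
    using fix_uv uv_ab by (auto simp: less_le)
  have a_b: "a < b" using uv_open by auto
  have small: "\<And>y. y \<in> A \<union> B \<Longrightarrow> \<bar>y\<bar> < 4 * \<epsilon>" using A B E.fixpoint_small by blast
  let ?J = "(t\<^sub>0 + a, t\<^sub>0 + b)" and ?I = "(s\<^sub>0 + a, s\<^sub>0 + b)"
  have points: "double_points (bumped e) \<inter> \<Psi> ` band a b = {\<Psi> (0, u), \<Psi> (0, v)}"
    unfolding E.double_points_band[OF ab] two by simp
  have distinct: "\<Psi> (0, u) \<noteq> \<Psi> (0, v)"
    using chart_eqD[of 0 u 0 v] E.bump_range[of u] E.bump_range[of v] fix_uv uv eps_delta eps_pos by auto
  have free: "crossingless (marked c R A' B') (\<Psi> ` band a b)" for A' B'
    unfolding crossingless_def curve_marked chart_bump.double_points_band[OF C ab]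
    using none by auto
  have crossing: "t\<^sub>0 + x \<in> open_strand ?J" "s\<^sub>0 + x \<in> open_strand ?I"
    "same_image (bumped e) (t\<^sub>0 + x) (s\<^sub>0 + x)" "bumped e (t\<^sub>0 + x) = \<Psi> (0, x)"
    "t\<^sub>0 + x \<in> over (marked e R A B) \<longleftrightarrow> x \<in> B" "s\<^sub>0 + x \<in> over (marked e R A B) \<longleftrightarrow> x \<in> A"
    if x: "x \<in> {u, v}" for x
  proof -
    have fx: "e x = x" "x \<in> {a<..<b}" using x fix_uv uv_open by auto
    have xd: "\<bar>x\<bar> < \<delta>" "\<bar>x\<bar> \<le> 10 * \<epsilon>" using E.bump_range[of x] fx E.fixpoint_box by auto
    show "t\<^sub>0 + x \<in> open_strand ?J" "s\<^sub>0 + x \<in> open_strand ?I"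
      by (rule open_strand_translate[OF _ fx(2)]; simp)+
    show "same_image (bumped e) (t\<^sub>0 + x) (s\<^sub>0 + x)"
      unfolding E.same_image_bumped using fx(1) by (intro disjI2 exI[of _ x]) simp
    show "bumped e (t\<^sub>0 + x) = \<Psi> (0, x)" using E.bumped_J[OF xd(1), of 0] by simp
    show "t\<^sub>0 + x \<in> over (marked e R A B) \<longleftrightarrow> x \<in> B"
      by (rule over_marked(2)[OF R small xd(2)]) simp_all
    show "s\<^sub>0 + x \<in> over (marked e R A B) \<longleftrightarrow> x \<in> A"
      by (rule over_marked(1)[OF R small xd(2)]) simp_all
  qed
  show "R2 (marked c R A (B - {u, v})) (marked e R A B)" if "u \<in> B" "v \<in> B"
  proof -
    have "over_crossing (marked e R A B) ?J ?I (\<Psi> (0, x))" if "x \<in> {u, v}" for x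
      using crossing[OF that] that \<open>u \<in> B\<close> \<open>v \<in> B\<close> unfolding over_crossing_def curve_marked by blast
    then have "bigon over_crossing (marked e R A B) (\<Psi> ` band a b) ?J ?I"
      unfolding bigon_def curve_marked using points distinct by blast
    moreover have "local_change (\<Psi> ` band a b) [?J, ?I] (marked c R A (B - {u, v})) (marked e R A B)"
      by (rule local_change_marked[OF C E ab(1) a_b ab(2) agree]) (use uv_open in auto)
    ultimately show ?thesis unfolding bigon_move_def using free by blast
  qed
  show "vR2 (marked c R A B) (marked e R A B)" if "u \<notin> A \<union> B" "v \<notin> A \<union> B"
  proof -
    have "virtual_crossing (marked e R A B) ?J ?I (\<Psi> (0, x))" if "x \<in> {u, v}" for x
      using crossing[OF that] that \<open>u \<notin> A \<union> B\<close> \<open>v \<notin> A \<union> B\<close>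
      unfolding virtual_crossing_def curve_marked by blast
    then have "bigon virtual_crossing (marked e R A B) (\<Psi> ` band a b) ?J ?I"
      unfolding bigon_def curve_marked using points distinct by blast
    moreover have "local_change (\<Psi> ` band a b) [?J, ?I] (marked c R A B) (marked e R A B)"
      by (rule local_change_marked[OF C E ab(1) a_b ab(2) agree]) auto
    ultimately show ?thesis unfolding bigon_move_def using free by blast
  qed
qed

end

section \<open>Two bump profiles\<close>

text \<open>A piecewise polynomial building block is enough, since diagrams are only required to be
  C1, and it keeps fixed points and slopes exactly computable.\<close>

definition pos_square :: "real \<Rightarrow> real" where
  "pos_square x = (max 0 x)\<^sup>2"

lemma pos_square_deriv: "(pos_square has_real_derivative 2 * max 0 x) (at x)"
proof -
  consider "x < 0" | "x = 0" | "0 < x" by linarith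
  then show ?thesis
  proof cases
    case 1
    have "((\<lambda>x. 0) has_real_derivative 2 * max 0 x) (at x)" using 1 by simp
    then show ?thesis
      by (rule has_field_derivative_transform_within_open[of _ _ _ "{..<0}"])
         (use 1 in \<open>auto simp: pos_square_def\<close>)
  next
    case 2
    \<comment> \<open>Caratheodory's criterion at 0, with the factorisation of
      \<open>pos_square z\<close> as \<open>max 0 z * z\<close>.\<close>
    have "\<exists>g. (\<forall>z. pos_square z - pos_square x = g z * (z - x)) \<and> isCont g x \<and> g x = 2 * max 0 x"
      by (intro exI[of _ "max 0"] conjI allI)
         (auto simp: 2 pos_square_def power2_eq_square max_def intro!: continuous_intros)
    then show ?thesis by (simp only: CARAT_DERIV)
  next
    case 3
    have "((\<lambda>x. x\<^sup>2) has_real_derivative 2 * max 0 x) (at x)"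
      using 3 by (auto intro!: derivative_eq_intros)
    then show ?thesis
      by (rule has_field_derivative_transform_within_open[of _ _ _ "{0<..}"])
         (use 3 in \<open>auto simp: pos_square_def\<close>)
  qed
qed

lemmas pos_square_chain [derivative_intros] = pos_square_deriv[THEN DERIV_chain2]

lemma pos_square_nonneg [simp]: "0 \<le> pos_square x" by (simp add: pos_square_def)

lemma pos_square_neg: "x \<le> 0 \<Longrightarrow> pos_square x = 0" by (simp add: pos_square_def)

lemma pos_square_pos: "0 \<le> x \<Longrightarrow> pos_square x = x\<^sup>2" by (simp add: pos_square_def)

text \<open>A C1 smoothing of \<open>max 0\<close>: zero up to -1, the identity from 1 on, and a
  parabola arc in between that meets the diagonal only at 1.\<close>

definition ramp :: "real \<Rightarrow> real" where
  "ramp x = (pos_square (x + 1) - pos_square (x - 1)) / 4"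

definition ramp' :: "real \<Rightarrow> real" where
  "ramp' x = (max 0 (x + 1) - max 0 (x - 1)) / 2"

lemma ramp_deriv: "(ramp has_real_derivative ramp' x) (at x)"
  unfolding ramp_def ramp'_def by (auto intro!: derivative_eq_intros simp: field_simps)

lemma ramp_right: "1 \<le> x \<Longrightarrow> ramp x = x"
  by (simp add: ramp_def pos_square_pos power2_eq_square algebra_simps)

lemma ramp_left: "x \<le> -1 \<Longrightarrow> ramp x = 0 \<and> ramp' x = 0"
  by (simp add: ramp_def ramp'_def pos_square_neg)

lemma ramp_middle: "-1 \<le> x \<Longrightarrow> x \<le> 1 \<Longrightarrow> ramp x = (x + 1)\<^sup>2 / 4"
  by (simp add: ramp_def pos_square_neg pos_square_pos)

lemma ramp_ge: "x \<le> ramp x"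
proof -
  consider "x \<le> -1" | "-1 \<le> x" "x \<le> 1" | "1 \<le> x" by linarith
  then show ?thesis
  proof cases
    case 2
    have "0 \<le> (x - 1)\<^sup>2" by simp
    then show ?thesis using ramp_middle[OF 2] by (simp add: power2_eq_square algebra_simps)
  qed (use ramp_left ramp_right in auto)
qed

lemma ramp_pos:
  assumes "-1 < x"
  shows "0 < ramp x"
proof (cases "x \<le> 1")
  case True
  have "0 < (x + 1)\<^sup>2 / 4" using assms by simp
  then show ?thesis using ramp_middle[of x] assms True by linarith
qed (use ramp_right in auto)

lemma ramp_nonneg: "0 \<le> ramp x"
  using ramp_left[of x] ramp_pos[of x] by (cases "x \<le> -1") auto

lemma ramp_le: "x \<le> 3 \<Longrightarrow> ramp x \<le> 3"
proof -
  assume x: "x \<le> 3"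
  consider "x \<le> -1" | "-1 \<le> x" "x \<le> 1" | "1 \<le> x" by linarith
  then show ?thesis
  proof cases
    case 2
    have "(x + 1)\<^sup>2 \<le> 2\<^sup>2" using 2 by (intro power_mono) auto
    then show ?thesis using ramp_middle[OF 2] by simp
  qed (use x ramp_left ramp_right in auto)
qed

text \<open>The strand with profile \<open>wiggle\<close> crosses at \<open>0\<close>, \<open>3/2\<close> and \<open>5/2\<close>, the one with profile
  \<open>shifted\<close> only at \<open>5/2\<close>; both agree outside \<open>{-2<..<2}\<close>.\<close>

definition wiggle :: "real \<Rightarrow> real" where
  "wiggle x = 16/9 * pos_square (1 - (x - 2)\<^sup>2) * ramp x"

definition wiggle' :: "real \<Rightarrow> real" where
  "wiggle' x = 16/9 * (pos_square (1 - (x - 2)\<^sup>2) * ramp' x - 4 * max 0 (1 - (x - 2)\<^sup>2) * (x - 2) * ramp x)"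

definition shifted :: "real \<Rightarrow> real" where
  "shifted x = 16/9 * pos_square (1 - pos_square (x - 2)) * ramp x"

definition shifted' :: "real \<Rightarrow> real" where
  "shifted' x = 16/9 * (pos_square (1 - pos_square (x - 2)) * ramp' x -
     4 * max 0 (1 - pos_square (x - 2)) * max 0 (x - 2) * ramp x)"

lemma wiggle_deriv: "(wiggle has_real_derivative wiggle' x) (at x)"
  unfolding wiggle_def[abs_def] wiggle'_def
  by (auto intro!: derivative_eq_intros ramp_deriv simp: field_simps)

lemma shifted_deriv: "(shifted has_real_derivative shifted' x) (at x)"
  unfolding shifted_def[abs_def] shifted'_def
  by (auto intro!: derivative_eq_intros ramp_deriv simp: field_simps)

lemma wiggle_cont: "continuous_on UNIV wiggle'" and shifted_cont: "continuous_on UNIV shifted'"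
  unfolding wiggle'_def[abs_def] shifted'_def[abs_def] ramp'_def ramp_def pos_square_def
  by (intro continuous_intros; simp)+

lemma wiggle_outside:
  assumes "x \<le> 1 \<or> 3 \<le> x"
  shows "wiggle x = 0" "wiggle' x = 0"
proof -
  have "1\<^sup>2 \<le> \<bar>x - 2\<bar>\<^sup>2" by (rule power_mono) (use assms in auto)
  then have "1 - (x - 2)\<^sup>2 \<le> 0" by simp
  then show "wiggle x = 0" "wiggle' x = 0" by (simp_all add: wiggle_def wiggle'_def pos_square_neg)
qed

lemma shifted_outside:
  assumes "x \<le> -1 \<or> 3 \<le> x"
  shows "shifted x = 0" "shifted' x = 0"
proof -
  have "ramp x = 0 \<and> ramp' x = 0 \<or> 1 - pos_square (x - 2) \<le> 0"
  proof (cases "x \<le> -1")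
    case False
    then have "1\<^sup>2 \<le> (x - 2)\<^sup>2" by (intro power_mono) (use assms in auto)
    then show ?thesis using False assms by (simp add: pos_square_pos)
  qed (use ramp_left in auto)
  then show "shifted x = 0" "shifted' x = 0"
    by (auto simp: shifted_def shifted'_def pos_square_neg)
qed

text \<open>The profiles differ only in \<open>pos_square (x - 2)\<close> against
  \<open>(x - 2)\<^sup>2\<close>. These agree from 2 on, and left of -1 both profiles
  vanish.\<close>

lemma shifted_eq_wiggle: "x \<le> -1 \<or> 2 \<le> x \<Longrightarrow> shifted x = wiggle x"
  using shifted_outside[of x] wiggle_outside[of x]
  by (cases "x \<le> -1") (auto simp: shifted_def wiggle_def pos_square_pos)

lemma shifted_left: "x \<le> 2 \<Longrightarrow> shifted x = 16/9 * ramp x"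
  by (simp add: shifted_def pos_square_neg pos_square_pos)

text \<open>Where the ramp is positive, the factor 16/9 lifts it strictly above itself and so above
  the diagonal; elsewhere \<open>x\<close> is negative and the profile is 0. This excludes all fixed
  points up to 2.\<close>

lemma shifted_above: "x \<le> 2 \<Longrightarrow> x < shifted x"
  using shifted_left[of x] ramp_ge[of x] ramp_pos[of x] ramp_nonneg[of x] by (cases "-1 < x") auto

text \<open>The constant 16/9 is the inverse square of 3/4: on this interval the ramp is the
  identity, so a fixed point solves \<open>1 - (x - 2)\<^sup>2 = 3/4\<close>, that is, it has
  distance 1/2 from 2.\<close>

lemma wiggle_fix_inside:
  assumes "1 < x" "x < 3"
  shows "wiggle x = x \<longleftrightarrow> x = 3/2 \<or> x = 5/2"
proof -
  define y where "y = 1 - (x - 2)\<^sup>2"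
  have "\<bar>x - 2\<bar>\<^sup>2 < 1\<^sup>2" by (rule power_strict_mono) (use assms in auto)
  then have y: "0 < y" by (simp add: y_def)
  have "wiggle x = x \<longleftrightarrow> 16/9 * y\<^sup>2 * x = x"
    using y assms by (simp add: wiggle_def ramp_right pos_square_pos y_def)
  also have "\<dots> \<longleftrightarrow> y\<^sup>2 = (3/4)\<^sup>2" using assms by (simp add: field_simps power2_eq_square)
  also have "\<dots> \<longleftrightarrow> y = 3/4" using y by (subst power2_eq_iff) auto
  also have "\<dots> \<longleftrightarrow> (x - 3/2) * (x - 5/2) = 0" by (auto simp: y_def power2_eq_square algebra_simps)
  also have "\<dots> \<longleftrightarrow> x = 3/2 \<or> x = 5/2" by auto
  finally show ?thesis .
qed

lemma wiggle_fix: "wiggle x = x \<longleftrightarrow> x = 0 \<or> x = 3/2 \<or> x = 5/2"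
  using wiggle_fix_inside[of x] wiggle_outside(1)[of x] by (cases "1 < x \<and> x < 3") auto

lemma shifted_fix: "shifted x = x \<longleftrightarrow> x = 5/2"
  using shifted_eq_wiggle[of x] shifted_above[of x] wiggle_fix[of x] by (cases "x \<le> 2") auto

text \<open>The slopes at 0, 3/2 and 5/2 are 0, 5 and -17/3.\<close>

lemma wiggle_fix_deriv: "wiggle x = x \<Longrightarrow> wiggle' x \<noteq> 1"
  unfolding wiggle_fix
  by (elim disjE; hypsubst; simp add: wiggle'_def ramp'_def ramp_def pos_square_def max_def power2_eq_square)

lemma shifted_fix_deriv: "shifted x = x \<Longrightarrow> shifted' x \<noteq> 1"
  unfolding shifted_fix
  by (hypsubst, simp add: shifted'_def ramp'_def ramp_def pos_square_def max_def power2_eq_square)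

text \<open>The ramp is at most 3 on this range, and 16/3 is less than the permitted height
  6.\<close>

lemma profile_bound:
  assumes "0 \<le> y" "y \<le> 1" "x \<le> 3"
  shows "\<bar>16/9 * pos_square y * ramp x\<bar> \<le> 6"
proof -
  have "pos_square y * ramp x \<le> 1 * 3"
    using assms ramp_nonneg ramp_le by (intro mult_mono) (auto simp: pos_square_pos power_le_one)
  moreover have "0 \<le> pos_square y * ramp x" using ramp_nonneg by simp
  ultimately show ?thesis by (simp add: mult.assoc)
qed

lemma wiggle_bound: "\<bar>wiggle x\<bar> \<le> 6"
proof (cases "1 < x \<and> x < 3")
  case True
  then have "\<bar>x - 2\<bar>\<^sup>2 \<le> 1\<^sup>2" by (intro power_mono) auto
  then show ?thesis unfolding wiggle_def using True by (intro profile_bound) auto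
qed (use wiggle_outside in force)

lemma shifted_bound: "\<bar>shifted x\<bar> \<le> 6"
proof (cases "x < 3")
  case True
  have "pos_square (x - 2) \<le> 1"
    using True unfolding pos_square_def by (intro power_le_one) auto
  then show ?thesis unfolding shifted_def using True by (intro profile_bound) auto
qed (use shifted_outside in force)

section \<open>Rescaling the profiles to the size of a chart\<close>

context crossing_chart
begin

definition scale :: "(real \<Rightarrow> real) \<Rightarrow> real \<Rightarrow> real" where
  "scale h x = \<epsilon> * h (x / \<epsilon>)"

lemma scale_fix: "scale h x = x \<longleftrightarrow> h (x / \<epsilon>) = x / \<epsilon>"
  using eps_pos by (auto simp: scale_def field_simps)

text \<open>Scaling both axes by \<open>\<epsilon>\<close> leaves slopes unchanged, so the
  transversality condition carries over without a factor.\<close>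

lemma chart_bump_scale:
  assumes der: "\<And>x. (h has_real_derivative h' x) (at x)" and cont: "continuous_on UNIV h'"
    and supp: "\<And>x. 4 \<le> \<bar>x\<bar> \<Longrightarrow> h x = 0 \<and> h' x = 0" and bound: "\<And>x. \<bar>h x\<bar> \<le> 6"
    and fin: "finite {x. h x = x}" and fixd: "\<And>x. h x = x \<Longrightarrow> h' x \<noteq> 1"
  shows "chart_bump \<gamma> s\<^sub>0 t\<^sub>0 \<delta> \<epsilon> (scale h) (\<lambda>x. h' (x / \<epsilon>))"
proof unfold_locales
  show "(scale h has_real_derivative h' (x / \<epsilon>)) (at x)" for x
    unfolding scale_def[abs_def] using eps_pos
    by (auto intro!: derivative_eq_intros DERIV_chain2[OF der])
  show "continuous_on UNIV (\<lambda>x. h' (x / \<epsilon>))"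
    using eps_pos by (intro continuous_on_compose2[OF cont] continuous_intros) auto
  show "scale h x = 0 \<and> h' (x / \<epsilon>) = 0" if "4 * \<epsilon> \<le> \<bar>x\<bar>" for x
    using supp[of "x / \<epsilon>"] that eps_pos by (simp add: scale_def field_simps)
  show "\<bar>scale h x\<bar> \<le> 6 * \<epsilon>" for x
    using bound[of "x / \<epsilon>"] eps_pos by (simp add: scale_def abs_mult)
  have "{x. scale h x = x} \<subseteq> (\<lambda>y. \<epsilon> * y) ` {x. h x = x}"
  proof
    fix x assume "x \<in> {x. scale h x = x}"
    then have "x / \<epsilon> \<in> {x. h x = x}" by (simp add: scale_fix)
    moreover have "x = \<epsilon> * (x / \<epsilon>)" using eps_pos by simp
    ultimately show "x \<in> (\<lambda>y. \<epsilon> * y) ` {x. h x = x}" by blast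
  qed
  then show "finite {x. scale h x = x}" by (rule finite_subset) (use fin in simp)
  show "h' (x / \<epsilon>) \<noteq> 1" if "scale h x = x" for x
    using that fixd scale_fix by blast
qed

lemma chart_bump_zero: "chart_bump \<gamma> s\<^sub>0 t\<^sub>0 \<delta> \<epsilon> (\<lambda>x. 0) (\<lambda>x. 0)"
  by unfold_locales (use eps_pos in auto)

lemma chart_bump_wiggle: "chart_bump \<gamma> s\<^sub>0 t\<^sub>0 \<delta> \<epsilon> (scale wiggle) (\<lambda>x. wiggle' (x / \<epsilon>))"
proof (rule chart_bump_scale[OF wiggle_deriv wiggle_cont _ wiggle_bound _ wiggle_fix_deriv])
  show "wiggle x = 0 \<and> wiggle' x = 0" if "4 \<le> \<bar>x\<bar>" for x
    using that wiggle_outside[of x] by (auto simp: abs_if split: if_splits)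
  have "{x. wiggle x = x} = {0, 3/2, 5/2}" using wiggle_fix by blast
  then show "finite {x. wiggle x = x}" by simp
qed

lemma chart_bump_shifted: "chart_bump \<gamma> s\<^sub>0 t\<^sub>0 \<delta> \<epsilon> (scale shifted) (\<lambda>x. shifted' (x / \<epsilon>))"
proof (rule chart_bump_scale[OF shifted_deriv shifted_cont _ shifted_bound _ shifted_fix_deriv])
  show "shifted x = 0 \<and> shifted' x = 0" if "4 \<le> \<bar>x\<bar>" for x
    using that shifted_outside[of x] by (auto simp: abs_if split: if_splits)
  have "{x. shifted x = x} = {5/2}" using shifted_fix by blast
  then show "finite {x. shifted x = x}" by simp
qed

end

section \<open>Replacing crossing changes by weldings\<close>

context crossing_chart
begin

lemma bumped_zero: "bumped (\<lambda>x. 0) = \<gamma>"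
  by (auto simp: bumped_def periodic_extension_def chart_axes)

lemma scale_wiggle_fix: "{x. scale wiggle x = x} = {0, 3/2 * \<epsilon>, 5/2 * \<epsilon>}"
  unfolding scale_fix wiggle_fix using eps_pos by (auto simp: field_simps)

lemma scale_shifted_fix: "{x. scale shifted x = x} = {5/2 * \<epsilon>}"
  unfolding scale_fix shifted_fix using eps_pos by (auto simp: field_simps)

lemma insert_bigon:
  assumes R: "residual_over R" and AB: "A \<subseteq> {0}" "B \<subseteq> {0}" "A \<inter> B = {}"
  shows "welded_step (marked (\<lambda>x. 0) R A B) (marked (scale wiggle) R A (B \<union> {3/2 * \<epsilon>, 5/2 * \<epsilon>}))"
proof -
  let ?B = "B \<union> {3/2 * \<epsilon>, 5/2 * \<epsilon>}"
  have fixpts: "A \<subseteq> {x. scale wiggle x = x}" "?B \<subseteq> {x. scale wiggle x = x}"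
    unfolding scale_wiggle_fix using AB by auto
  \<comment> \<open>In units of \<open>\<epsilon>\<close>, the interval from 1/2 to 7/2 contains the
    support of \<open>wiggle\<close> and stays below 4, but excludes 0, which is a fixed point of
    the zero bump too.\<close>
  have "R2 (marked (\<lambda>x. 0) R A (?B - {3/2 * \<epsilon>, 5/2 * \<epsilon>})) (marked (scale wiggle) R A ?B)"
  proof (rule bigon_marked(1)[where a = "1/2 * \<epsilon>" and b = "7/2 * \<epsilon>",
        OF chart_bump_zero chart_bump_wiggle _ _ _ _ _ _ R fixpts])
    show "0 = scale wiggle x" if "x \<notin> {1/2 * \<epsilon><..<7/2 * \<epsilon>}" for x
      using that eps_pos wiggle_outside(1)[of "x / \<epsilon>"] by (auto simp: scale_def field_simps)
    have "{x. scale wiggle x = x \<and> 1/2 * \<epsilon> \<le> x \<and> x \<le> 7/2 * \<epsilon>} =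
        {x. scale wiggle x = x} \<inter> {1/2 * \<epsilon>..7/2 * \<epsilon>}" by auto
    then show "{x. scale wiggle x = x \<and> 1/2 * \<epsilon> \<le> x \<and> x \<le> 7/2 * \<epsilon>} = {3/2 * \<epsilon>, 5/2 * \<epsilon>}"
      unfolding scale_wiggle_fix using eps_pos by auto
  qed (use eps_pos in auto)
  moreover have "?B - {3/2 * \<epsilon>, 5/2 * \<epsilon>} = B" using AB eps_pos by auto
  moreover have "virtual_diagram (marked (\<lambda>x. 0) R A B)"
    by (rule chart_bump.virtual_diagram_marked[OF chart_bump_zero R]) (use AB in auto)
  moreover have "virtual_diagram (marked (scale wiggle) R A ?B)"
    by (rule chart_bump.virtual_diagram_marked[OF chart_bump_wiggle R fixpts]) (use AB eps_pos in auto)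
  ultimately show ?thesis by (simp add: welded_step_def)
qed

text \<open>Two crossings next to each other can be removed by a second Reidemeister move both when they are
  welded and when the same strand is over at each of them. Comparing the two ways to remove two of
  three crossings moves the remaining one from \<open>5/2 * \<epsilon>\<close> to \<open>0\<close>.\<close>

lemma slide_crossing:
  assumes R: "residual_over R"
  shows "(marked (scale wiggle) R {} {5/2 * \<epsilon>}, marked (\<lambda>x. 0) R {} {0}) \<in> welded_equivalence"
proof -
  let ?w = "scale wiggle" and ?f = "scale shifted" and ?q = "5/2 * \<epsilon>"
  let ?B = "{0, 3/2 * \<epsilon>, ?q}"
  \<comment> \<open>This interval contains the fixed points 0 and 3/2 of the wiggle but not 5/2, and
    beyond it the two profiles coincide (all in units of \<open>\<epsilon>\<close>).\<close>
  note ab = bigon_marked[where a = "- (2 * \<epsilon>)" and b = "2 * \<epsilon>" and u = 0 and v = "3/2 * \<epsilon>",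
      OF chart_bump_shifted chart_bump_wiggle]
  have agree: "?f x = ?w x" if "x \<notin> {- (2 * \<epsilon>)<..<2 * \<epsilon>}" for x
    using that eps_pos shifted_eq_wiggle[of "x / \<epsilon>"] by (auto simp: scale_def field_simps)
  have none: "?f x \<noteq> x" if "x \<le> 2 * \<epsilon>" for x
    using that eps_pos scale_shifted_fix by force
  have "{x. ?w x = x \<and> - (2 * \<epsilon>) \<le> x \<and> x \<le> 2 * \<epsilon>} = {x. ?w x = x} \<inter> {- (2 * \<epsilon>)..2 * \<epsilon>}" by auto
  then have two: "{x. ?w x = x \<and> - (2 * \<epsilon>) \<le> x \<and> x \<le> 2 * \<epsilon>} = {0, 3/2 * \<epsilon>}"
    unfolding scale_wiggle_fix using eps_pos by auto
  have w: "{?q} \<subseteq> {x. ?w x = x}" "?B \<subseteq> {x. ?w x = x}" unfolding scale_wiggle_fix by auto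
  have vd: "virtual_diagram (marked ?f R {} {?q})"
    by (rule chart_bump.virtual_diagram_marked[OF chart_bump_shifted R])
       (use scale_shifted_fix in auto)
  have vd': "virtual_diagram (marked ?w R {} B)" if "B \<subseteq> {x. ?w x = x}" for B
    by (rule chart_bump.virtual_diagram_marked[OF chart_bump_wiggle R _ that]) auto
  have "R2 (marked ?f R {} (?B - {0, 3/2 * \<epsilon>})) (marked ?w R {} ?B)"
    by (rule ab(1)[OF _ _ agree none two _ R _ w(2)]) (use eps_pos in auto)
  moreover have "?B - {0, 3/2 * \<epsilon>} = {?q}" using eps_pos by auto
  ultimately have 1: "welded_step (marked ?f R {} {?q}) (marked ?w R {} ?B)"
    using vd vd'[OF w(2)] by (simp add: welded_step_def)
  have "vR2 (marked ?f R {} {?q}) (marked ?w R {} {?q})"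
    by (rule ab(2)[OF _ _ agree none two _ R _ w(1)]) (use eps_pos in auto)
  then have 2: "welded_step (marked ?f R {} {?q}) (marked ?w R {} {?q})"
    using vd vd'[OF w(1)] by (simp add: welded_step_def)
  have 3: "welded_step (marked (\<lambda>x. 0) R {} {0}) (marked ?w R {} ?B)"
    using insert_bigon[OF R, of "{}" "{0}"] by (simp add: insert_commute)
  have "equivclp welded_step (marked ?w R {} {?q}) (marked ?f R {} {?q})"
    using 2 by (blast intro: equivclp_sym r_into_equivclp)
  also have "equivclp welded_step (marked ?f R {} {?q}) (marked ?w R {} ?B)"
    using 1 by (blast intro: r_into_equivclp)
  also have "equivclp welded_step (marked ?w R {} ?B) (marked (\<lambda>x. 0) R {} {0})"
    using 3 by (blast intro: equivclp_sym r_into_equivclp)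
  finally show ?thesis
    using 2 3 by (simp add: welded_equivalence_def welded_step_def)
qed

lemma at_crossing_iff: "\<gamma> t = \<gamma> s\<^sub>0 \<longleftrightarrow> t - s\<^sub>0 \<in> \<int> \<or> t - t\<^sub>0 \<in> \<int>"
proof
  assume "\<gamma> t = \<gamma> s\<^sub>0"
  then show "t - s\<^sub>0 \<in> \<int> \<or> t - t\<^sub>0 \<in> \<int>"
    using generic crossing_eq crossing_not_int unfolding generic_immersion_def by metis
qed (use congruent crossing_eq in metis)

lemma residual_over_diagram:
  assumes "virtual_diagram G" "curve G = \<gamma>"
  shows "residual_over {t \<in> over G. \<gamma> t \<noteq> \<gamma> s\<^sub>0}"
  using assms periodic[of _ 1] unfolding virtual_diagram_def residual_over_def by auto

lemma marked_zero:
  assumes "curve G = \<gamma>"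
    and "\<And>t. \<gamma> t = \<gamma> s\<^sub>0 \<Longrightarrow> t \<in> over G \<longleftrightarrow> (\<exists>x\<in>A. t - (s\<^sub>0 + x) \<in> \<int>) \<or> (\<exists>x\<in>B. t - (t\<^sub>0 + x) \<in> \<int>)"
    and "A \<subseteq> {0}" "B \<subseteq> {0}"
  shows "marked (\<lambda>x. 0) {t \<in> over G. \<gamma> t \<noteq> \<gamma> s\<^sub>0} A B = G"
proof -
  have "(\<exists>x\<in>A. t - (s\<^sub>0 + x) \<in> \<int>) \<or> (\<exists>x\<in>B. t - (t\<^sub>0 + x) \<in> \<int>) \<Longrightarrow> \<gamma> t = \<gamma> s\<^sub>0" for t
    using assms(3,4) unfolding at_crossing_iff by auto
  then have "over (marked (\<lambda>x. 0) {t \<in> over G. \<gamma> t \<noteq> \<gamma> s\<^sub>0} A B) = over G"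
    using assms(2) unfolding marked_def vdiagram.simps by blast
  then show ?thesis using assms(1) bumped_zero by simp
qed

end

section \<open>From one crossing change to all of them\<close>

lemma over_congruent:
  assumes "virtual_diagram D" "s - t \<in> \<int>"
  shows "s \<in> over D \<longleftrightarrow> t \<in> over D"
proof -
  have 1: "t + 1 \<in> over D \<longleftrightarrow> t \<in> over D" for t using assms(1) by (simp add: virtual_diagram_def)
  have nat: "t + real k \<in> over D \<longleftrightarrow> t \<in> over D" for t k
  proof (induction k)
    case (Suc k) then show ?case using 1[of "t + real k"] by (simp add: algebra_simps)
  qed simp
  obtain n :: int where n: "s - t = of_int n" using assms(2) by (auto elim: Ints_cases)
  show ?thesis
  proof (cases "n \<ge> 0")
    case True
    then have "s = t + real (nat n)" using n by simp
    then show ?thesis using nat by simp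
  next
    case False
    then have "t = s + real (nat (- n))" using n by simp
    then show ?thesis using nat[of s] by simp
  qed
qed

lemma classical_crossing_double_point:
  assumes "virtual_diagram D" "p \<in> classical_crossings D"
  obtains s t where "s \<in> over D" "curve D s = p" "same_image (curve D) s t"
proof -
  obtain s where "s \<in> over D" "curve D s = p" using assms(2) by (auto simp: classical_crossings_def)
  moreover then obtain t where "same_image (curve D) t s"
    using assms(1) unfolding virtual_diagram_def by blast
  ultimately show ?thesis using that same_image_sym by blast
qed

text \<open>The inclusion of crossings keeps the pending sets \<open>X - {p}\<close> and
  \<open>Y\<close> meaningful in \<open>E\<close>. That \<open>q\<close> is new keeps the enlarged
  welding set disjoint from the remaining switches, as the induction needs.\<close>

lemma replace_switch_by_weldings:
  assumes D: "virtual_diagram D" and X: "X \<subseteq> classical_crossings D" and Y: "Y \<subseteq> classical_crossings D"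
    and XY: "X \<inter> Y = {}" and p: "p \<in> X"
  obtains E q where "(D, E) \<in> welded_equivalence"
    "classical_crossings D \<subseteq> classical_crossings E"
    "q \<in> classical_crossings E" "q \<notin> classical_crossings D"
    "(weld (insert p (insert q Y)) (switch (X - {p}) E), weld Y (switch X D)) \<in> welded_equivalence"
proof -
  define \<gamma> where "\<gamma> = curve D"
  obtain s\<^sub>0 t\<^sub>0 where s0: "s\<^sub>0 \<in> over D" "\<gamma> s\<^sub>0 = p" and st: "same_image \<gamma> s\<^sub>0 t\<^sub>0"
    unfolding \<gamma>_def using p X by (blast elim: classical_crossing_double_point[OF D])
  have gen: "generic_immersion \<gamma>" using D by (simp add: virtual_diagram_def \<gamma>_def)
  obtain \<delta> \<epsilon> where "crossing_chart \<gamma> s\<^sub>0 t\<^sub>0 \<delta> \<epsilon>" by (rule crossing_chart_exists[OF gen st])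
  then interpret crossing_chart \<gamma> s\<^sub>0 t\<^sub>0 \<delta> \<epsilon> .
  let ?w = "scale wiggle" and ?q\<^sub>1 = "3/2 * \<epsilon>" and ?q\<^sub>2 = "5/2 * \<epsilon>"
  interpret W: chart_bump \<gamma> s\<^sub>0 t\<^sub>0 \<delta> \<epsilon> ?w "\<lambda>x. wiggle' (x / \<epsilon>)" by (rule chart_bump_wiggle)
  have q_small: "\<bar>?q\<^sub>1\<bar> \<le> 10 * \<epsilon>" "\<bar>?q\<^sub>2\<bar> \<le> 10 * \<epsilon>" "\<bar>?q\<^sub>1\<bar> < \<delta>" "0 \<noteq> ?q\<^sub>1" "?q\<^sub>1 \<noteq> ?q\<^sub>2" "?q\<^sub>2 \<noteq> 0"
    using eps_pos eps_delta by auto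
  define G where "G = weld Y (switch X D)"
  define R where "R = {t \<in> over D. \<gamma> t \<noteq> \<gamma> s\<^sub>0}"
  \<comment> \<open>\<open>R\<close> marks the other crossings as they are in \<open>D\<close>,
    \<open>S\<close> as they are in the target \<open>G\<close>. Performing the pending switches and
    weldings on \<open>E\<close> turns the first into the second.\<close>
  define S where "S = {t \<in> over G. \<gamma> t \<noteq> \<gamma> s\<^sub>0}"
  define E where "E = marked ?w R {0} {?q\<^sub>1, ?q\<^sub>2}"
  define q where "q = \<Psi> (0, ?q\<^sub>1)"
  have G: "virtual_diagram G" unfolding G_def by (intro virtual_diagram_weld virtual_diagram_switch D X)
  have curve_G: "curve G = \<gamma>" by (simp add: G_def weld_def switch_def \<gamma>_def)
  have over_G: "t \<in> over G \<longleftrightarrow> (t \<in> over D) \<noteq> (\<gamma> t \<in> X) \<and> \<gamma> t \<notin> Y" for t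
    by (auto simp: G_def weld_def switch_def \<gamma>_def)
  have R: "residual_over R" unfolding R_def by (rule residual_over_diagram[OF D]) (simp add: \<gamma>_def)
  have S: "residual_over S" unfolding S_def by (rule residual_over_diagram[OF G curve_G])
  have t0: "t\<^sub>0 \<notin> over D"
    using D s0 st unfolding virtual_diagram_def \<gamma>_def by blast
  have over_p: "t \<in> over D \<longleftrightarrow> t - s\<^sub>0 \<in> \<int>" "t \<notin> over D \<longleftrightarrow> t - t\<^sub>0 \<in> \<int>" if t: "\<gamma> t = \<gamma> s\<^sub>0" for t
  proof -
    have "t - s\<^sub>0 \<in> \<int> \<Longrightarrow> t \<in> over D" "t - t\<^sub>0 \<in> \<int> \<Longrightarrow> t \<notin> over D"
      using over_congruent[OF D] s0 t0 by blast+
    then show "t \<in> over D \<longleftrightarrow> t - s\<^sub>0 \<in> \<int>" "t \<notin> over D \<longleftrightarrow> t - t\<^sub>0 \<in> \<int>"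
      using t unfolding at_crossing_iff by blast+
  qed
  have D_marked: "marked (\<lambda>x. 0) R {0} {} = D"
    unfolding R_def by (rule marked_zero) (auto simp: \<gamma>_def[symmetric] over_p(1))
  have G_marked: "marked (\<lambda>x. 0) S {} {0} = G"
    unfolding S_def
  proof (rule marked_zero[OF curve_G])
    fix t assume t: "\<gamma> t = \<gamma> s\<^sub>0"
    \<comment> \<open>The crossing \<open>p\<close> is switched and not welded, so in
      \<open>G\<close> the strand of \<open>t\<^sub>0\<close> is over.\<close>
    have "t \<in> over G \<longleftrightarrow> t \<notin> over D" using p XY s0 t unfolding over_G by auto
    then show "t \<in> over G \<longleftrightarrow> (\<exists>x\<in>{}. t - (s\<^sub>0 + x) \<in> \<int>) \<or> (\<exists>x\<in>{0}. t - (t\<^sub>0 + x) \<in> \<int>)"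
      using over_p(2)[OF t] by simp
  qed auto
  have step: "welded_step D E"
    using insert_bigon[OF R, of "{0}" "{}"] unfolding D_marked E_def by simp
  then have DE: "(D, E) \<in> welded_equivalence"
    by (auto simp: welded_equivalence_def welded_step_def intro: r_into_equivclp)
  have p_chart: "p = \<Psi> (0, 0)" using s0 by (simp add: chart_axes crossing_eq)
  have small: "\<And>y. y \<in> {0} \<union> {?q\<^sub>1, ?q\<^sub>2} \<Longrightarrow> \<bar>y\<bar> < 4 * \<epsilon>"
    "\<And>y. y \<in> {} \<union> {?q\<^sub>2} \<Longrightarrow> \<bar>y\<bar> < 4 * \<epsilon>" using eps_pos by auto
  have crossing_in_box: "x = 0 \<and> y = 0"
    if "\<Psi> (x, y) \<in> classical_crossings D" "\<bar>x\<bar> \<le> 10 * \<epsilon>" "\<bar>y\<bar> \<le> 10 * \<epsilon>" for x y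
    using classical_crossing_double_point[OF D that(1)] chart_double_point[OF that(2,3)]
    unfolding \<gamma>_def by metis
  have q: "q \<notin> classical_crossings D"
    using crossing_in_box[of 0 ?q\<^sub>1] q_small eps_pos unfolding q_def by auto
  have cc: "x \<in> classical_crossings E" if x: "x \<in> classical_crossings D" for x
  proof -
    obtain s t where s: "s \<in> over D" "\<gamma> s = x" "same_image \<gamma> s t"
      using classical_crossing_double_point[OF D x] unfolding \<gamma>_def by blast
    show ?thesis
    proof (cases "x = p")
      case True
      have "?w 0 = 0" using scale_wiggle_fix by blast
      then have "bumped ?w s\<^sub>0 = p" using W.bumped_I[of 0 0] eps_delta eps_pos p_chart by simp
      moreover have "s\<^sub>0 \<in> over E" by (simp add: E_def marked_def)
      ultimately show ?thesis using True by (force simp: classical_crossings_def E_def)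
    next
      case False
      then have "\<gamma> s \<noteq> \<gamma> s\<^sub>0" using s s0 by simp
      then have "bumped ?w s = x" "s \<in> over E"
        using W.bumped_far[OF far_if_double_point[OF s(3)]] s by (auto simp: E_def marked_def R_def)
      then show ?thesis by (force simp: classical_crossings_def E_def)
    qed
  qed
  have "bumped ?w (t\<^sub>0 + ?q\<^sub>1) = q" using W.bumped_J[of ?q\<^sub>1 0] q_small by (simp add: q_def)
  moreover have "t\<^sub>0 + ?q\<^sub>1 \<in> over E" by (simp add: E_def marked_def)
  ultimately have qE: "q \<in> classical_crossings E" by (force simp: classical_crossings_def E_def)
  let ?H = "weld (insert p (insert q Y)) (switch (X - {p}) E)"
  have over_H: "t \<in> over ?H \<longleftrightarrow>
      (t \<in> over E) \<noteq> (bumped ?w t \<in> X - {p}) \<and> bumped ?w t \<notin> insert p (insert q Y)" for t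
    by (auto simp: weld_def switch_def E_def)
  \<comment> \<open>Once 0 and \<open>?q\<^sub>1\<close> are welded, only the crossing at
    \<open>?q\<^sub>2\<close> keeps a mark in the box. Outside the box the curve is unchanged and
    the over-set is that of \<open>G\<close>.\<close>
  have "t \<in> over ?H \<longleftrightarrow> t \<in> over (marked ?w S {} {?q\<^sub>2})" for t
  proof (cases "\<exists>x y. \<bar>x\<bar> \<le> 10 * \<epsilon> \<and> \<bar>y\<bar> \<le> 10 * \<epsilon> \<and> bumped ?w t = \<Psi> (x, y)")
    case True
    then obtain x y where xy: "\<bar>x\<bar> \<le> 10 * \<epsilon>" "\<bar>y\<bar> \<le> 10 * \<epsilon>" and t: "bumped ?w t = \<Psi> (x, y)" by blast
    \<comment> \<open>The only crossing of \<open>D\<close> in the box is \<open>p\<close>, so the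
      other switches and the old weldings leave the box untouched.\<close>
    have "\<Psi> (x, y) \<notin> X - {p}" "\<Psi> (x, y) \<notin> Y"
      using crossing_in_box[OF _ xy] X Y p XY p_chart by auto
    then have H: "t \<in> over ?H \<longleftrightarrow> t \<in> over E \<and> \<Psi> (x, y) \<noteq> p \<and> \<Psi> (x, y) \<noteq> q"
      unfolding over_H t by simp
    from W.bumped_eq_chart_iff[OF xy, THEN iffD1, OF t] show ?thesis
    proof (elim disjE exE conjE)
      fix z n assume z: "\<bar>z\<bar> < \<delta>" "t = s\<^sub>0 + z + real_of_int n" "x = z - ?w z" "y = ?w z"
      have z_small: "\<bar>z\<bar> \<le> 10 * \<epsilon>"
        using W.bump_support[of z] xy z eps_pos by (cases "4 * \<epsilon> \<le> \<bar>z\<bar>") auto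
      have tz: "t - (s\<^sub>0 + z) \<in> \<int>" using z by simp
      have "t \<in> over E \<longleftrightarrow> z \<in> {0}"
        unfolding E_def by (rule over_marked(1)[OF R small(1) z_small tz])
      moreover have "t \<in> over (marked ?w S {} {?q\<^sub>2}) \<longleftrightarrow> z \<in> {}"
        by (rule over_marked(1)[OF S small(2) z_small tz])
      moreover have "\<Psi> (x, y) = p" if "z = 0"
      proof -
        have "?w 0 = 0" using scale_wiggle_fix by blast
        then show ?thesis using z that p_chart by simp
      qed
      ultimately show ?thesis using H by auto
    next
      fix n assume y: "t = t\<^sub>0 + y + real_of_int n" "x = 0"
      have ty: "t - (t\<^sub>0 + y) \<in> \<int>" using y by simp
      have "t \<in> over E \<longleftrightarrow> y \<in> {?q\<^sub>1, ?q\<^sub>2}"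
        unfolding E_def by (rule over_marked(2)[OF R small(1) xy(2) ty])
      moreover have "t \<in> over (marked ?w S {} {?q\<^sub>2}) \<longleftrightarrow> y \<in> {?q\<^sub>2}"
        by (rule over_marked(2)[OF S small(2) xy(2) ty])
      moreover have "\<Psi> (x, y) = \<Psi> (0, z) \<longleftrightarrow> y = z" if "\<bar>z\<bar> < \<delta>" for z
        using chart_eqD[of 0 y 0 z] that xy(2) y(2) eps_delta eps_pos by auto
      then have "\<Psi> (x, y) = p \<longleftrightarrow> y = 0" "\<Psi> (x, y) = q \<longleftrightarrow> y = ?q\<^sub>1"
        unfolding p_chart q_def using q_small eps_delta eps_pos by auto
      ultimately show ?thesis using H q_small by auto
    qed
  next
    case False
    then have t: "bumped ?w t = \<gamma> t" by (cases t rule: W.bumped_cases) auto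
    have ne: "\<gamma> t \<noteq> \<Psi> (x, y)" if "\<bar>x\<bar> \<le> 10 * \<epsilon>" "\<bar>y\<bar> \<le> 10 * \<epsilon>" for x y
      using False t that by auto
    have pq: "\<gamma> t \<noteq> p" "\<gamma> t \<noteq> q" unfolding p_chart q_def using ne q_small eps_pos by auto
    have "t - (t\<^sub>0 + x) \<notin> \<int>" "t - (s\<^sub>0 + x) \<notin> \<int>" if "\<bar>x\<bar> \<le> 10 * \<epsilon>" for x
      using ne[of 0 x] ne[of x 0] congruent[of t "t\<^sub>0 + x"] congruent[of t "s\<^sub>0 + x"] that eps_pos
      by (auto simp: chart_axes)
    note off = this(1)[OF q_small(1)] this(1)[OF q_small(2)] this(2)[of 0]
    have "t \<in> over E \<longleftrightarrow> t \<in> over D"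
      using off eps_pos pq s0 by (simp add: E_def marked_def R_def)
    moreover have "t \<in> over (marked ?w S {} {?q\<^sub>2}) \<longleftrightarrow> t \<in> over G"
      using off pq s0 by (simp add: marked_def S_def)
    ultimately show ?thesis unfolding over_H t over_G using pq by auto
  qed
  then have "over ?H = over (marked ?w S {} {?q\<^sub>2})" by blast
  moreover have "curve ?H = bumped ?w" by (simp add: weld_def switch_def E_def)
  ultimately have "?H = marked ?w S {} {?q\<^sub>2}" by simp
  then have "(?H, weld Y (switch X D)) \<in> welded_equivalence"
    using slide_crossing[OF S] unfolding G_marked G_def by simp
  then show ?thesis using that DE cc qE q by blast
qed

lemma switch_empty: "switch {} D = D" by (simp add: switch_def)

lemma weld_empty: "weld {} D = D" by (simp add: weld_def)

text \<open>\<open>Y\<close> accumulates the weldings. One replacement takes \<open>p\<close> out of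
  \<open>X\<close> and puts \<open>p\<close> and \<open>q\<close> into \<open>Y\<close>, so the
  budget \<open>card Y + 2 * card X\<close> does not grow. The diagram is generalised because the
  remaining switches are performed on the new one.\<close>

lemma replace_switches_by_weldings:
  assumes "finite X" "virtual_diagram D" "X \<subseteq> classical_crossings D"
    "finite Y" "Y \<subseteq> classical_crossings D" "X \<inter> Y = {}"
  shows "\<exists>E Z. (D, E) \<in> welded_equivalence \<and> Z \<subseteq> classical_crossings E \<and>
    card Z \<le> card Y + 2 * card X \<and> (weld Z E, weld Y (switch X D)) \<in> welded_equivalence"
  using assms
proof (induction X arbitrary: D Y rule: finite_induct)
  case empty
  then show ?case
    using equiv_welded_equivalence virtual_diagram_weld[of D Y]
    by (intro exI[of _ D] exI[of _ Y]) (auto simp: switch_empty equiv_def refl_on_def)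
next
  case (insert p X)
  obtain E q where E: "(D, E) \<in> welded_equivalence" "classical_crossings D \<subseteq> classical_crossings E"
    "q \<in> classical_crossings E" "q \<notin> classical_crossings D"
    "(weld (insert p (insert q Y)) (switch (insert p X - {p}) E), weld Y (switch (insert p X) D))
       \<in> welded_equivalence"
    by (rule replace_switch_by_weldings[OF insert.prems(1,2,4,5) insertI1])
  have "insert p X - {p} = X" using insert.hyps by auto
  note step = E(5)[unfolded this]
  have "\<exists>F Z. (E, F) \<in> welded_equivalence \<and> Z \<subseteq> classical_crossings F \<and>
    card Z \<le> card (insert p (insert q Y)) + 2 * card X \<and>
    (weld Z F, weld (insert p (insert q Y)) (switch X E)) \<in> welded_equivalence"
    using insert.prems insert.hyps E by (intro insert.IH) (auto simp: welded_equivalence_def)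
  then obtain F Z where F: "(E, F) \<in> welded_equivalence" "Z \<subseteq> classical_crossings F"
    "card Z \<le> card (insert p (insert q Y)) + 2 * card X"
    "(weld Z F, weld (insert p (insert q Y)) (switch X E)) \<in> welded_equivalence" by blast
  have trans: "trans welded_equivalence" using equiv_welded_equivalence by (simp add: equiv_def)
  have "card (insert p (insert q Y)) \<le> card Y + 2"
    using card_insert_le_m1[of "card Y + 2" "insert q Y" p] card_insert_le_m1[of "card Y + 1" Y q] by simp
  then have "card Z \<le> card Y + 2 * card (insert p X)" using F(3) insert.hyps by simp
  then show ?case using transD[OF trans E(1) F(1)] transD[OF trans F(4) step] F(2) by blast
qed

text \<open>Well-ordering turns the infima into minima, so an optimal diagram and an optimal set of
  crossings can be fixed.\<close>

lemma Inf_enat_attained: "A \<noteq> {} \<Longrightarrow> Inf A \<in> (A :: enat set)"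
  unfolding Inf_enat_def by (auto intro: LeastI)

theorem proposition3p6:
  fixes K :: "vdiagram set"
  assumes "K \<in> welded_knots"
  shows "welded_unknotting_number K \<le> 2 * unknotting_number K"
proof (cases "unknotting_number K = \<infinity>")
  case False
  have trans: "trans welded_equivalence" and sym: "sym welded_equivalence"
    using equiv_welded_equivalence by (simp_all add: equiv_def)
  \<comment> \<open>An infimum over the empty set is infinite, so finiteness of the unknotting
    number provides the witnesses, here and for \<open>?U\<close>.\<close>
  have "K \<noteq> {}" using False unfolding unknotting_number_def by (auto simp: top_enat_def)
  then obtain D where D: "D \<in> K" "unknotting_number K = diagram_unknotting_number D"
    using Inf_enat_attained[of "diagram_unknotting_number ` K"] unfolding unknotting_number_def by auto
  let ?U = "{X. X \<subseteq> classical_crossings D \<and> switch X D \<in> unknot}"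
  have "?U \<noteq> {}"
    using False D(2) unfolding diagram_unknotting_number_def by (metis INF_empty top_enat_def)
  then obtain X where X: "X \<subseteq> classical_crossings D" "switch X D \<in> unknot"
      and u: "unknotting_number K = enat (card X)"
    using Inf_enat_attained[of "(\<lambda>X. enat (card X)) ` ?U"] D(2)
    unfolding diagram_unknotting_number_def by auto
  obtain D\<^sub>0 where K: "K = welded_equivalence `` {D\<^sub>0}"
    using assms by (auto simp: welded_knots_def elim: quotientE)
  have vD: "virtual_diagram D" using D(1) K by (auto simp: welded_equivalence_def)
  have "finite X" using X(1) finite_classical_crossings[OF vD] by (rule finite_subset)
  from replace_switches_by_weldings[OF this vD X(1), of "{}"]
  obtain E Z where E: "(D, E) \<in> welded_equivalence" "Z \<subseteq> classical_crossings E"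
    "card Z \<le> 2 * card X" "(weld Z E, switch X D) \<in> welded_equivalence"
    by (auto simp: weld_empty)
  have "E \<in> K" using D(1) E(1) K trans by (auto dest: transD)
  moreover have "weld Z E \<in> unknot"
    using X(2) symD[OF sym E(4)] trans unfolding unknot_def by (auto dest: transD)
  ultimately have "welded_unknotting_number K \<le> enat (card Z)"
    unfolding welded_unknotting_number_def diagram_welded_unknotting_number_def
    using E(2) by (intro INF_lower2[of E] INF_lower2[of Z]) auto
  also have "\<dots> \<le> 2 * unknotting_number K"
    using E(3) unfolding u by (simp add: numeral_eq_enat)
  finally show ?thesis .
qed (simp add: imult_infinity_right)

end
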